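(* For all non-negative integers $L,t$, positive integers $p,p'$ such that $p' > p$, and any integer $n\ge 2$, \[ \begin{aligned} D_{3^t\cdot2^np',3^t\cdot2^ns}\Bigg(&L+3^t\cdot2^{n-2}+3^t\cdot2^{n-1}(r-s),\,L-3^t\cdot2^{n-2}-3^t\cdot2^{n-1}(r-s);\\ &\frac{\frac{2^{2n}-1}{3}(2p'-1)-\frac{2^{2n+1}+1}{3}r+p}{2^n}-(3^t-1)\cdot2^{n-2}+(3^t-1)\cdot2^{n-1}(p'-r),\\ &\frac{\frac{2^{2n+1}+1}{3}r+\frac{2^{2n}-1}{3}}{2^n}+(3^t-1)\cdot2^{n-2}+(3^t-1)\cdot2^{n-1}r\Bigg) \ge 0, \end{aligned} \] where $r$, $s$ are integers such that $0 < r < p$ and $0 < s < p'$.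
   Context: The $q$-binomial coefficient is $\begin{bmatrix}m\\ n\end{bmatrix}_q=\frac{(q;q)_m}{(q;q)_n(q;q)_{m-n}}$ for $m\ge n\ge 0$ and $0$ otherwise, where $(a;q)_L=\prod_{k=0}^{L-1}(1-aq^k)$. For integers $K,i$ and (possibly rational) parameters $N,M,\alpha,\beta$, \[ D_{K,i}(N,M;\alpha,\beta)=\sum_{j\in\mathbb{Z}}\left\{q^{j((\alpha+\beta)Kj+K\beta-(\alpha+\beta)i)}\begin{bmatrix}M+N\\ M-Kj\end{bmatrix}_{q}-q^{((\alpha+\beta)j+\beta)(Kj+i)}\begin{bmatrix}M+N\\ M-Kj-i\end{bmatrix}_{q}\right\}. \] "$P(q)\ge 0$" means the power series $P(q)$ has non-negative coefficients. *)

theory Defs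
  imports "HOL-Computational_Algebra.Polynomial"
begin

definition qpoch :: "nat \<Rightarrow> int poly" where
  "qpoch L = (\<Prod>k<L. 1 - monom 1 (k + 1))"

text \<open>q-binomial coefficient [m choose n]_q for integers m, n; zero unless m >= n >= 0.
  The division is exact polynomial division.\<close>
definition qbinom :: "int \<Rightarrow> int \<Rightarrow> int poly" where
  "qbinom m n = (if 0 \<le> n \<and> n \<le> m
     then qpoch (nat m) div (qpoch (nat n) * qpoch (nat (m - n))) else 0)"

definition qcoeff :: "int poly \<Rightarrow> rat \<Rightarrow> int" where
  "qcoeff p x = (if x \<in> \<int> \<and> 0 \<le> x then coeff p (nat \<lfloor>x\<rfloor>) else 0)"

text \<open>Coefficient of q^e in D_{K,i}(N,M;alpha,beta). Exponents may a priori be rational, so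
  D is treated as a generalized power series in q with rational exponents. The sum over j in Z
  is restricted to those j for which the q-binomial can be non-zero (a finite set when K ~= 0).\<close>
definition Dcoeff :: "int \<Rightarrow> int \<Rightarrow> int \<Rightarrow> int \<Rightarrow> rat \<Rightarrow> rat \<Rightarrow> rat \<Rightarrow> int" where
  "Dcoeff K i N M \<alpha> \<beta> e =
     (\<Sum>j\<in>{j::int. 0 \<le> M - K*j \<and> M - K*j \<le> M + N}.
        qcoeff (qbinom (M + N) (M - K*j))
          (e - of_int j * ((\<alpha>+\<beta>) * of_int K * of_int j + of_int K * \<beta> - (\<alpha>+\<beta>) * of_int i)))
   - (\<Sum>j\<in>{j::int. 0 \<le> M - K*j - i \<and> M - K*j - i \<le> M + N}.
        qcoeff (qbinom (M + N) (M - K*j - i))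
          (e - ((\<alpha>+\<beta>) * of_int j + \<beta>) * of_int (K*j + i)))"

definition D_nonneg :: "int \<Rightarrow> int \<Rightarrow> int \<Rightarrow> int \<Rightarrow> rat \<Rightarrow> rat \<Rightarrow> bool" where
  "D_nonneg K i N M \<alpha> \<beta> \<longleftrightarrow> (\<forall>e. 0 \<le> Dcoeff K i N M \<alpha> \<beta> e)"

end

theory Submission
  imports Defs "HOL-Computational_Algebra.Formal_Laurent_Series"
begin

text \<open>
  The starting point is $D_{p',s}(N, M; p - r, r)$ with $N - M$ equal to $r - s$ or $r - s + 1$. It is
  non-negative because $D_{K,i}(N, M; p - b, b)$ satisfies two Pascal recurrences with positive
  coefficients, one of which always preserves the bounds
  $b - i \<le> N - M \<le> K - p + b - i$ and $0 \<le> b \<le> p$, until a vanishing or trivial case is reached.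

  Positivity is then transported by summation formulas with positive kernels that act on each term
  separately. Writing $[m; k]$ for the $q$-binomial coefficient, they express
  $q^{b(b+1)/2} [2L+1; L-b]$ through the $[k; \<lfloor>(k-b)/2\<rfloor>]$ (used once),
  $q^{a^2/2} [2L; L-a]$ through the $[k; (k-a)/2]$ (used $n - 1$ times), and
  $q^{3x^2} [2L; L-3x]$ through the $[2r; r-x]$ in base $q^3$ (used $t$ times). The first two are
  double applications of the $q$-Vandermonde sum, the third is a $q$-Pfaff--Saalschuetz sum.
\<close>

section \<open>Gaussian binomials over a field\<close>

definition qfact :: "'a::field \<Rightarrow> nat \<Rightarrow> 'a" where
  "qfact q n = (\<Prod>k<n. 1 - q ^ (k + 1))"

text \<open>With the convention $1/(q;q)_n = 0$ for $n < 0$ the recurrences in $n$ hold for all integers.\<close>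

definition rqfact :: "'a::field \<Rightarrow> int \<Rightarrow> 'a" where
  "rqfact q n = (if n < 0 then 0 else inverse (qfact q (nat n)))"

definition gbinom :: "'a::field \<Rightarrow> nat \<Rightarrow> int \<Rightarrow> 'a" where
  "gbinom q m n = qfact q m * rqfact q n * rqfact q (int m - n)"

lemma qfact_0 [simp]: "qfact q 0 = 1"
  by (simp add: qfact_def)

lemma qfact_Suc: "qfact q (Suc n) = qfact q n * (1 - q ^ Suc n)"
  by (simp add: qfact_def)

lemma rqfact_neg [simp]: "n < 0 \<Longrightarrow> rqfact q n = 0"
  by (simp add: rqfact_def)

lemma rqfact_of_nat: "rqfact q (int n) = inverse (qfact q n)"
  by (simp add: rqfact_def)

lemma gbinom_sym: "gbinom q m (int m - n) = gbinom q m n"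
  by (simp add: gbinom_def mult_ac)

lemma gbinom_eq_0: "n < 0 \<or> int m < n \<Longrightarrow> gbinom q m n = 0"
  by (auto simp: gbinom_def)

lemma gbinom_0_left: "gbinom q 0 n = (if n = 0 then 1 else 0)"
  by (auto simp: gbinom_def rqfact_def)

text \<open>The base is an abstract field element because the cubic transformation relates base
  \<open>q\<close> to base \<open>q ^ 3\<close>; both are instances.\<close>

locale generic_base =
  fixes q :: "'a::field"
  assumes nonzero: "q \<noteq> 0" and not_root_of_unity: "0 < n \<Longrightarrow> q ^ n \<noteq> 1"
begin

lemma qfact_nonzero [simp]: "qfact q n \<noteq> 0"
  using not_root_of_unity by (simp add: qfact_def) (metis zero_less_Suc power_Suc)

lemma powi_add: "q powi (m + n) = q powi m * q powi n"
  using nonzero by (simp add: power_int_add)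

text \<open>At n = 0 both sides vanish because 1 - q^0 = 0, which makes the convention for negative
  arguments consistent.\<close>

lemma rqfact_pred: "rqfact q (n - 1) = (1 - q powi n) * rqfact q n"
proof (cases "n \<le> 0")
  case True
  then show ?thesis by (cases "n = 0") auto
next
  case False
  define m where "m = nat (n - 1)"
  have n: "n = int (Suc m)" using False by (simp add: m_def)
  have "qfact q (Suc m) \<noteq> 0" by (rule qfact_nonzero)
  then have "1 - q ^ Suc m \<noteq> 0" unfolding qfact_Suc by simp
  moreover have "q powi n = q ^ Suc m" unfolding n by (rule power_int_of_nat)
  moreover have "n - 1 = int m" using n by simp
  ultimately show ?thesis
    unfolding rqfact_def n by (simp add: qfact_Suc nat_add_distrib field_simps)
qed

lemma qfact_rqfact [simp]: "qfact q n * rqfact q (int n) = 1"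
  by (simp add: rqfact_def)

text \<open>Over a common denominator this is 1 - q^(m+1) = q^n (1 - q^(m+1-n)) + (1 - q^n).\<close>

lemma gbinom_Suc: "gbinom q (Suc m) n = q powi n * gbinom q m n + gbinom q m (n - 1)"
proof -
  have 1: "rqfact q (int m - n) = (1 - q powi (int m + 1 - n)) * rqfact q (int m + 1 - n)"
    using rqfact_pred[of "int m + 1 - n"] by (simp add: algebra_simps)
  have 2: "q powi n * q powi (int m + 1 - n) = q ^ Suc m"
    unfolding powi_add[symmetric] power_int_of_nat[symmetric] by (rule arg_cong[where f = "\<lambda>k. q powi k"]) simp
  have 3: "int (Suc m) - n = int m + 1 - n" "int m - (n - 1) = int m + 1 - n" by simp_all
  show ?thesis
    unfolding gbinom_def 3 1 qfact_Suc rqfact_pred[of n] 2[symmetric] by (simp add: algebra_simps)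
qed

lemma gbinom_Suc': "gbinom q (Suc m) n = gbinom q m n + q powi (int m + 1 - n) * gbinom q m (n - 1)"
  using gbinom_Suc[of m "int (Suc m) - n"] gbinom_sym[of q m "n - 1"] gbinom_sym[of q m n]
  unfolding gbinom_sym[of q "Suc m"]
  by (simp add: algebra_simps)

text \<open>Induction on n with the second Pascal rule in the right-hand binomial. The rule also
  lowers the shift c, so c is kept arbitrary.\<close>

lemma q_vandermonde:
  "(\<Sum>h=0..int m. q powi (h * (h + c)) * gbinom q m h * gbinom q n (h + c)) = gbinom q (m + n) (int m + c)"
proof (induction n arbitrary: c)
  case 0
  show ?case
  proof (cases "0 \<le> -c \<and> -c \<le> int m")
    case True
    have "(\<Sum>h=0..int m. q powi (h * (h + c)) * gbinom q m h * gbinom q 0 (h + c)) =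
      (\<Sum>h\<in>{-c}. q powi (h * (h + c)) * gbinom q m h * gbinom q 0 (h + c))"
      by (rule sum.mono_neutral_right) (use True in \<open>auto simp: gbinom_0_left split: if_splits\<close>)
    then show ?thesis using gbinom_sym[of q m "-c"] by (simp add: gbinom_0_left)
  next
    case False
    then have "gbinom q m (int m + c) = 0" by (intro gbinom_eq_0) auto
    moreover have "(\<Sum>h=0..int m. q powi (h * (h + c)) * gbinom q m h * gbinom q 0 (h + c)) = 0"
      using False by (intro sum.neutral) (auto simp: gbinom_0_left split: if_splits)
    ultimately show ?thesis by simp
  qed
next
  case (Suc n)
  \<comment> \<open>The Pascal weight turns the quadratic exponent for c into the one for c - 1, up
    to a power free of h.\<close>
  have e: "q powi (h * (h + c)) * (q powi (int n + 1 - (h + c))) = q powi (int n + 1 - c) * q powi (h * (h + (c - 1)))" for h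
    unfolding powi_add[symmetric] by (rule arg_cong[where f = "\<lambda>k. q powi k"]) (simp add: algebra_simps)
  have "(\<Sum>h=0..int m. q powi (h * (h + c)) * gbinom q m h * gbinom q (Suc n) (h + c)) =
    (\<Sum>h=0..int m. q powi (h * (h + c)) * gbinom q m h * gbinom q n (h + c)) +
    q powi (int n + 1 - c) * (\<Sum>h=0..int m. q powi (h * (h + (c - 1))) * gbinom q m h * gbinom q n (h + (c - 1)))"
    unfolding gbinom_Suc' sum_distrib_left sum.distrib[symmetric]
    by (rule sum.cong) (use e in \<open>simp_all add: algebra_simps\<close>)
  also have "\<dots> = gbinom q (m + n) (int m + c) + q powi (int n + 1 - c) * gbinom q (m + n) (int m + (c - 1))"
    unfolding Suc.IH ..
  also have "\<dots> = gbinom q (m + Suc n) (int m + c)"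
    by (simp add: gbinom_Suc' algebra_simps)
  finally show ?case .
qed

section \<open>Quadratic transformations\<close>

text \<open>The inner factorials (q)_s and (q)_k cancel between neighbouring factors, leaving a
  multinomial with parts L - s, s - k, u, k - u.\<close>

lemma gbinom_chain:
  assumes "0 \<le> s" "0 \<le> k"
  shows "gbinom q L s * gbinom q (nat s) k * gbinom q (nat k) u =
    qfact q L * rqfact q (int L - s) * rqfact q (s - k) * rqfact q u * rqfact q (k - u)"
  using assms qfact_rqfact[of "nat s"] qfact_rqfact[of "nat k"]
  by (simp add: gbinom_def) (simp add: algebra_simps)

lemma gbinom_fork:
  assumes "0 \<le> h" "h \<le> int L"
  shows "gbinom q L h * gbinom q (nat h) u * gbinom q (nat (int L - h)) v =
    qfact q L * rqfact q u * rqfact q (h - u) * rqfact q v * rqfact q (int L - h - v)"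
  using assms qfact_rqfact[of "nat h"] qfact_rqfact[of "nat (int L - h)"]
  by (simp add: gbinom_def) (simp add: algebra_simps)

text \<open>Substituting $k = 2u + c$ and $s = h + u + c$ turns both products of $q$-binomials into
  the same symmetric multinomial expression.\<close>

lemma sum_chain_eq_sum_fork:
  "(\<Sum>(k, s)\<in>{0..int L} \<times> {0..int L}. W s k * (gbinom q L s * gbinom q (nat s) k *
      (if even (k - c) then gbinom q (nat k) ((k - c) div 2) else 0))) =
   (\<Sum>(h, u)\<in>{0..int L} \<times> {0..int L}. W (h + u + c) (2 * u + c) *
      (gbinom q L h * gbinom q (nat h) u * gbinom q (nat (int L - h)) (u + c)))"
  (is "sum ?F ?A = sum ?G ?A")
proof -
  \<comment> \<open>The substitution does not preserve the box of indices, only the supports: a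
    non-zero term forces all arguments of \<open>rqfact\<close> to be non-negative, and these
    inequalities give the bounds.\<close>
  let ?S = "{x \<in> ?A. ?F x \<noteq> 0}" and ?T = "{x \<in> ?A. ?G x \<noteq> 0}"
  let ?j = "\<lambda>(k, s). (s - (k + c) div 2, (k - c) div 2)" and ?i = "\<lambda>(h, u). (2 * u + c, h + u + c)"
  have to: "?i (?j x) = x \<and> ?j x \<in> ?T \<and> ?G (?j x) = ?F x" if x: "x \<in> ?S" for x
  proof -
    obtain k s where ks: "x = (k, s)" by (cases x)
    have nz: "?F (k, s) \<noteq> 0" and r: "0 \<le> k" "k \<le> int L" "0 \<le> s" "s \<le> int L" using x ks by auto
    then have ev: "even (k - c)" by (auto split: if_splits)
    then obtain u where u: "k = 2 * u + c" by (metis add.commute diff_add_cancel dvdE)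
    have nz': "gbinom q L s * gbinom q (nat s) k * gbinom q (nat k) u \<noteq> 0"
      using nz ev u by auto
    have eq: "?F (k, s) = ?G (s - u - c, u)"
      if "0 \<le> s - u - c" "s - u - c \<le> int L"
      using ev u r that gbinom_chain[of s k L u] gbinom_fork[of "s - u - c" L u "u + c"]
      by (simp add: algebra_simps)
    from nz' have "\<not> int L - s < 0" "\<not> s - k < 0" "\<not> u < 0" "\<not> k - u < 0"
      unfolding gbinom_chain[OF r(3,1)] using rqfact_neg by fastforce+
    then have b: "0 \<le> s - u - c" "s - u - c \<le> int L" "0 \<le> u" "u \<le> int L"
      using u r by linarith+
    have "(k + c) div 2 = u + c" "(k - c) div 2 = u" using u by auto
    then have jx: "?j x = (s - u - c, u)" using ks by simp
    have "?G (s - u - c, u) \<noteq> 0" using eq[OF b(1,2)] nz by (rule back_subst[where P = "\<lambda>y. y \<noteq> 0", rotated])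
    then show ?thesis unfolding jx using b eq[OF b(1,2)] ks u by simp
  qed
  have fro: "?j (?i x) = x \<and> ?i x \<in> ?S" if x: "x \<in> ?T" for x
  proof -
    obtain h u where hu: "x = (h, u)" by (cases x)
    have nz: "?G (h, u) \<noteq> 0" and r: "0 \<le> h" "h \<le> int L" "0 \<le> u" "u \<le> int L" using x hu by auto
    then have "gbinom q L h * gbinom q (nat h) u * gbinom q (nat (int L - h)) (u + c) \<noteq> 0" by auto
    then have "\<not> u + c < 0" "\<not> h - u < 0" "\<not> int L - h - (u + c) < 0"
      unfolding gbinom_fork[OF r(1,2)] using rqfact_neg by fastforce+
    then have b: "0 \<le> 2 * u + c" "2 * u + c \<le> int L" "0 \<le> h + u + c" "h + u + c \<le> int L"
      using r by linarith+
    have eq: "?F (2 * u + c, h + u + c) = ?G (h, u)"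
      using b r gbinom_chain[of "h + u + c" "2 * u + c" L u] gbinom_fork[of h L u "u + c"]
      by (simp add: algebra_simps)
    show ?thesis
      using hu b eq nz by simp
  qed
  have "sum ?F ?A = sum ?F ?S" by (rule sum.mono_neutral_right) auto
  also have "\<dots> = sum ?G ?T"
    by (rule sum.reindex_bij_witness[where i = ?i and j = ?j]) (use to fro in blast)+
  also have "\<dots> = sum ?G ?A" by (rule sum.mono_neutral_left) auto
  finally show ?thesis .
qed

text \<open>The assumption separates the u-part u (u + c) of the exponent, so after the substitution
  the sum over u is a q-Vandermonde sum with tops h and L - h, and only the sum over h is
  left.\<close>

lemma sum_quadratic:
  assumes "\<And>h u. e (h + u + c) (2 * u + c) = u * (u + c) + f h"
  shows "(\<Sum>k=0..int L. (\<Sum>s=0..int L. q powi e s k * gbinom q L s * gbinom q (nat s) k) *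
      (if even (k - c) then gbinom q (nat k) ((k - c) div 2) else 0)) =
    (\<Sum>h=0..int L. q powi f h * gbinom q L h * gbinom q L (h + c))"
proof -
  have vd: "(\<Sum>u=0..int L. q powi (u * (u + c)) * (gbinom q (nat h) u * gbinom q (nat (int L - h)) (u + c))) =
      gbinom q L (h + c)" if h: "h \<in> {0..int L}" for h
  proof -
    have "(\<Sum>u=0..int L. q powi (u * (u + c)) * (gbinom q (nat h) u * gbinom q (nat (int L - h)) (u + c))) =
      (\<Sum>u=0..int (nat h). q powi (u * (u + c)) * gbinom q (nat h) u * gbinom q (nat (int L - h)) (u + c))"
      by (rule sum.mono_neutral_cong_right) (use h in \<open>auto simp: gbinom_eq_0\<close>)
    also have "\<dots> = gbinom q L (h + c)"
      unfolding q_vandermonde using h by (simp flip: nat_add_distrib)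
    finally show ?thesis .
  qed
  have "(\<Sum>k=0..int L. (\<Sum>s=0..int L. q powi e s k * gbinom q L s * gbinom q (nat s) k) *
      (if even (k - c) then gbinom q (nat k) ((k - c) div 2) else 0)) =
    (\<Sum>(k, s)\<in>{0..int L} \<times> {0..int L}. q powi e s k * (gbinom q L s * gbinom q (nat s) k *
      (if even (k - c) then gbinom q (nat k) ((k - c) div 2) else 0)))"
    by (simp only: sum_distrib_right sum.cartesian_product mult.assoc)
  also have "\<dots> = (\<Sum>h=0..int L. \<Sum>u=0..int L. q powi f h * gbinom q L h *
      (q powi (u * (u + c)) * (gbinom q (nat h) u * gbinom q (nat (int L - h)) (u + c))))"
    unfolding sum.cartesian_product sum_chain_eq_sum_fork
    by (rule sum.cong, simp) (simp only: case_prod_beta assms powi_add, simp only: mult_ac)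
  also have "\<dots> = (\<Sum>h=0..int L. q powi f h * gbinom q L h * gbinom q L (h + c))"
    unfolding sum_distrib_left[symmetric] by (rule sum.cong) (simp_all only: vd)
  finally show ?thesis .
qed

text \<open>The numerator of the exponent has the parity of k. Only k of the parity of c enter the
  transformation, so the rounding in \<open>div 2\<close> is the same as in
  \<open>c\<^sup>2 div 2\<close>.\<close>

definition quad_kernel :: "nat \<Rightarrow> int \<Rightarrow> 'a" where
  "quad_kernel L k = (\<Sum>s=0..int L. q powi ((s\<^sup>2 + (s - k)\<^sup>2) div 2) * gbinom q L s * gbinom q (nat s) k)"

text \<open>The exponent splits by (h+u+c)^2 + (h-u)^2 = 2u(u+c) + 2h(h+c) + c^2; the remaining sum
  over h is a second q-Vandermonde sum.\<close>

lemma quad_transform: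
  "(\<Sum>k=0..int L. quad_kernel L k * (if even (k - c) then gbinom q (nat k) ((k - c) div 2) else 0)) =
    q powi (c\<^sup>2 div 2) * gbinom q (2 * L) (int L - c)"
proof -
  have e: "((h + u + c)\<^sup>2 + (h + u + c - (2 * u + c))\<^sup>2) div 2 = u * (u + c) + (h * (h + c) + c\<^sup>2 div 2)" for h u :: int
  proof -
    have "(h + u + c)\<^sup>2 + (h + u + c - (2 * u + c))\<^sup>2 = 2 * (u * (u + c) + h * (h + c)) + c\<^sup>2"
      by (simp add: power2_eq_square algebra_simps)
    then show ?thesis by simp
  qed
  have 1: "int (L + L) - (int L + c) = int L - c" by simp
  show ?thesis
    unfolding quad_kernel_def sum_quadratic[of "\<lambda>s k. (s\<^sup>2 + (s - k)\<^sup>2) div 2", OF e]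
      mult_2 gbinom_sym[of q "L + L" "int L + c", unfolded 1] q_vandermonde[symmetric]
      sum_distrib_left powi_add
    by (simp only: mult_ac)
qed

definition odd_quad_kernel :: "nat \<Rightarrow> int \<Rightarrow> 'a" where
  "odd_quad_kernel L k =
    (\<Sum>s=0..int L. q powi (s * s - s * k + s + k * (k - 1) div 2) * gbinom q L s * gbinom q (nat s) k)"

text \<open>Both parities of k contribute: even k - b is the case c = b of
  \<open>sum_quadratic\<close>, odd k - b the case c = b + 1. Pascal's rule merges the two sums over
  h into one with top L + 1, whence the odd top 2L + 1.\<close>

lemma odd_quad_transform:
  "(\<Sum>k=0..int L. odd_quad_kernel L k * gbinom q (nat k) ((k - b) div 2)) =
    q powi (b * (b + 1) div 2) * gbinom q (2 * L + 1) (int L - b)"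
proof -
  have e: "(h + u + c) * (h + u + c) - (h + u + c) * (2 * u + c) + (h + u + c) + (2 * u + c) * (2 * u + c - 1) div 2
      = u * (u + c) + (h * (h + c + 1) + c * (c + 1) div 2)" for c h u :: int
  proof -
    have "(2 * u + c) * (2 * u + c - 1) = c * (c + 1) + (2 * u * u + 2 * u * c - u - c) * 2"
      by (simp add: algebra_simps)
    then have "(2 * u + c) * (2 * u + c - 1) div 2 = c * (c + 1) div 2 + (2 * u * u + 2 * u * c - u - c)"
      by simp
    then show ?thesis by (simp add: algebra_simps)
  qed
  have b: "(b + 1) * (b + 1 + 1) div 2 = b * (b + 1) div 2 + (b + 1)"
  proof -
    have "(b + 1) * (b + 1 + 1) = b * (b + 1) + (b + 1) * 2" by (simp add: algebra_simps)
    then show ?thesis by simp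
  qed
  note S = sum_quadratic[of "\<lambda>s k. s * s - s * k + s + k * (k - 1) div 2", OF e, folded odd_quad_kernel_def]
  have "(\<Sum>k=0..int L. odd_quad_kernel L k * gbinom q (nat k) ((k - b) div 2)) =
    (\<Sum>k=0..int L. odd_quad_kernel L k * (if even (k - b) then gbinom q (nat k) ((k - b) div 2) else 0)) +
    (\<Sum>k=0..int L. odd_quad_kernel L k * (if even (k - (b + 1)) then gbinom q (nat k) ((k - (b + 1)) div 2) else 0))"
    unfolding sum.distrib[symmetric]
  proof (rule sum.cong)
    fix k :: int
    have "(k - (b + 1)) div 2 = (k - b) div 2" if "odd (k - b)" using that by presburger
    then show "odd_quad_kernel L k * gbinom q (nat k) ((k - b) div 2) =
      odd_quad_kernel L k * (if even (k - b) then gbinom q (nat k) ((k - b) div 2) else 0) +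
      odd_quad_kernel L k * (if even (k - (b + 1)) then gbinom q (nat k) ((k - (b + 1)) div 2) else 0)"
      by auto
  qed simp
  also have "\<dots> = q powi (b * (b + 1) div 2) *
    (\<Sum>h=0..int L. q powi (h * (h + (b + 1))) * gbinom q L h * gbinom q (Suc L) (h + (b + 1)))"
  proof -
    have "h * (h + (b + 1) + 1) + (b * (b + 1) div 2 + (b + 1)) =
      b * (b + 1) div 2 + h * (h + (b + 1)) + (h + (b + 1))" for h by (simp add: algebra_simps)
    then have 1: "q powi (h * (h + (b + 1) + 1) + (b * (b + 1) div 2 + (b + 1))) =
      q powi (b * (b + 1) div 2) * q powi (h * (h + (b + 1))) * q powi (h + (b + 1))" for h
      by (simp only: powi_add)
    have 2: "h + (b + 1) - 1 = h + b" "h * (h + b + 1) = h * (h + (b + 1))" for h by simp_all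
    show ?thesis
      unfolding S b 1 gbinom_Suc 2 sum_distrib_left sum.distrib[symmetric] powi_add[of _ "b * (b + 1) div 2"]
      by (rule sum.cong) (simp_all add: algebra_simps)
  qed
  also have "\<dots> = q powi (b * (b + 1) div 2) * gbinom q (2 * L + 1) (int L - b)"
  proof -
    have 1: "L + Suc L = 2 * L + 1" by simp
    have 2: "int (2 * L + 1) - (int L - b) = int L + (b + 1)" by simp
    show ?thesis
      unfolding q_vandermonde 1 using gbinom_sym[of q "2 * L + 1" "int L - b", unfolded 2] by simp
  qed
  finally show ?thesis .
qed

section \<open>The cubic transformation\<close>

lemma generic_base_cube: "generic_base (q ^ 3)"
  by unfold_locales (use nonzero not_root_of_unity[of "3 * n" for n] in \<open>simp_all flip: power_mult\<close>)

definition cubic_term :: "nat \<Rightarrow> int \<Rightarrow> int \<Rightarrow> 'a" where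
  "cubic_term L j r = (q ^ 3) powi (r * r) * qfact (q ^ 3) (nat (int L - 1 - r)) *
     rqfact q (int L - 3 * r) * rqfact (q ^ 3) (r - j) * rqfact (q ^ 3) (r + j)"

text \<open>The $q$-Pfaff--Saalschuetz sum behind the cubic transformation is proved by creative telescoping in
  \<open>L\<close>; the certificate is the WZ mate of the summand.\<close>

definition cubic_certificate :: "nat \<Rightarrow> int \<Rightarrow> int \<Rightarrow> 'a" where
  "cubic_certificate L j r = - (q powi (1 + int L) * (q ^ 3) powi (r * r - r) * qfact (q ^ 3) (nat (int L - r)) *
     rqfact q (int L + 1 - 3 * r) * rqfact (q ^ 3) (r - j - 1) * rqfact (q ^ 3) (r + j - 1))"

text \<open>Every term is a rational function of q, y = q^L, z = q^(3r), w = q^(3j) times the common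
  product E P A B C, so the claim reduces to the rational identity \<open>main\<close>. The bound r
  < L keeps L - 1 - r a natural number.\<close>

lemma cubic_telescoping:
  fixes r :: int
  assumes "0 \<le> r" "r < int L"
  shows "(1 - q powi (int L + 1 - 3 * j)) * (1 - q powi (int L + 1 + 3 * j)) * cubic_term (Suc L) j r -
      (1 - q powi (2 * int L)) * (1 - q powi (2 * int L + 1)) * cubic_term L j r =
    cubic_certificate L j (r + 1) - cubic_certificate L j r"
proof -
  interpret cube: generic_base "q ^ 3" by (rule generic_base_cube)
  define y z w where "y = q powi int L" and "z = q powi (3 * r)" and "w = q powi (3 * j)"
  have nz: "y \<noteq> 0" "z \<noteq> 0" "w \<noteq> 0" using nonzero by (simp_all add: y_def z_def w_def)
  define E P A B C where "E = (q ^ 3) powi (r * r)" and "P = qfact (q ^ 3) (nat (int L - 1 - r))"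
    and "A = rqfact q (int L + 1 - 3 * r)" and "B = rqfact (q ^ 3) (r - j)" and "C = rqfact (q ^ 3) (r + j)"
  have cube: "(q ^ 3) powi m = q powi (3 * m)" for m by (simp add: power_int_mult)
  have neg: "q powi (m - n) = q powi m / q powi n" for m n using nonzero by (simp add: power_int_diff)
  have P': "qfact (q ^ 3) (nat (int L - r)) = P * (1 - y ^ 3 / z)"
  proof -
    have "nat (int L - r) = Suc (nat (int L - 1 - r))" using assms by simp
    moreover have "(q ^ 3) ^ Suc (nat (int L - 1 - r)) = (q ^ 3) powi (int L - r)"
      by (subst power_int_of_nat[symmetric], rule arg_cong[where f = "\<lambda>k. (q ^ 3) powi k"]) (use assms in simp)
    moreover have "(q ^ 3) powi (int L - r) = y ^ 3 / z"
      using nonzero by (simp add: cube neg y_def z_def right_diff_distrib power_int_mult mult.commute[of 3])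
    ultimately show ?thesis by (simp add: qfact_Suc P_def)
  qed
  have A1: "rqfact q (int L - 3 * r) = (1 - q * y / z) * A"
    using rqfact_pred[of "int L + 1 - 3 * r"] by (simp add: A_def neg powi_add y_def z_def mult.commute)
  have A2: "rqfact q (int L - 1 - 3 * r) = (1 - y / z) * ((1 - q * y / z) * A)"
    unfolding A1[symmetric] using rqfact_pred[of "int L - 3 * r"]
    by (simp add: neg y_def z_def algebra_simps)
  have A3: "rqfact q (int L - 2 - 3 * r) = (1 - y / (q * z)) * ((1 - y / z) * ((1 - q * y / z) * A))"
  proof -
    have "q powi (int L - 1 - 3 * r) = y / (q * z)" by (simp add: neg y_def z_def)
    moreover have "int L - 1 - 3 * r - 1 = int L - 2 - 3 * r" by simp
    ultimately show ?thesis using rqfact_pred[of "int L - 1 - 3 * r"] by (simp only: A2)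
  qed
  have B': "rqfact (q ^ 3) (r - j - 1) = (1 - z / w) * B"
    using cube.rqfact_pred[of "r - j"] by (simp add: B_def cube right_diff_distrib neg z_def w_def)
  have C': "rqfact (q ^ 3) (r + j - 1) = (1 - z * w) * C"
    using cube.rqfact_pred[of "r + j"] by (simp add: C_def cube distrib_left powi_add z_def w_def)
  have E1: "(q ^ 3) powi (r * r - r) = E / z"
    using nonzero by (simp add: E_def power_int_diff cube z_def)
  have E2: "(q ^ 3) powi ((r + 1) * (r + 1) - (r + 1)) = E * z"
    by (simp add: E_def cube z_def flip: powi_add) (simp add: algebra_simps)
  have T0: "cubic_term L j r = E * P * ((1 - q * y / z) * A) * B * C"
    by (simp add: cubic_term_def A1 E_def P_def B_def C_def)
  have T1: "cubic_term (Suc L) j r = E * (P * (1 - y ^ 3 / z)) * A * B * C"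
    by (simp add: cubic_term_def E_def B_def C_def A_def add.commute flip: P')
  have G0: "cubic_certificate L j r =
      - (q * y * (E / z) * (P * (1 - y ^ 3 / z)) * A * ((1 - z / w) * B) * ((1 - z * w) * C))"
    by (simp add: cubic_certificate_def E1 P' A_def B' C' powi_add y_def)
  have e3: "int L - (r + 1) = int L - 1 - r" "int L + 1 - 3 * (r + 1) = int L - 2 - 3 * r"
    "r + 1 - j - 1 = r - j" "r + 1 + j - 1 = r + j" by simp_all
  have G1: "cubic_certificate L j (r + 1) =
      - (q * y * (E * z) * P * ((1 - y / (q * z)) * ((1 - y / z) * ((1 - q * y / z) * A))) * B * C)"
    unfolding cubic_certificate_def E2 e3 A3 by (simp add: P_def B_def C_def powi_add y_def)
  have main: "(1 - q * y / w) * (1 - q * y * w) * (1 - y ^ 3 / z) - (1 - y ^ 2) * (1 - q * y ^ 2) * (1 - q * y / z) =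
      - (q * y * z) * ((1 - y / (q * z)) * (1 - y / z) * (1 - q * y / z)) +
      q * y / z * (1 - y ^ 3 / z) * (1 - z / w) * (1 - z * w)"
    using nonzero nz by (simp add: field_simps power2_eq_square power3_eq_cube)
  have coeffs: "q powi (int L + 1 - 3 * j) = q * y / w" "q powi (int L + 1 + 3 * j) = q * y * w"
    "q powi (2 * int L) = y ^ 2" "q powi (2 * int L + 1) = q * y ^ 2"
    using nonzero by (simp_all add: neg powi_add y_def w_def power_int_mult mult.commute[of 2])
  have scale: "a * b * (E * (P * c) * A * B * C) - d * f * (E * P * (g * A) * B * C) =
      - (q * y * (E * z) * P * (h * (k * (g * A))) * B * C) - - (q * y * (E / z) * (P * c) * A * (l * B) * (m * C))"
    if "a * b * c - d * f * g = - (q * y * z) * (h * k * g) + q * y / z * c * l * m" for a b c d f g h k l m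
    using arg_cong[OF that, of "\<lambda>t. t * (E * P * A * B * C)"] by (simp add: algebra_simps)
  show ?thesis
    unfolding coeffs T0 T1 G0 G1 by (rule scale[OF main])
qed

lemma cubic_sum_Suc:
  assumes "0 \<le> j" "0 < L"
  shows "(1 - q powi (int L + 1 - 3 * j)) * (1 - q powi (int L + 1 + 3 * j)) * (\<Sum>r<Suc L. cubic_term (Suc L) j (int r)) =
    (1 - q powi (2 * int L)) * (1 - q powi (2 * int L + 1)) * (\<Sum>r<L. cubic_term L j (int r))"
proof -
  have "(1 - q powi (int L + 1 - 3 * j)) * (1 - q powi (int L + 1 + 3 * j)) * (\<Sum>r<L. cubic_term (Suc L) j (int r)) -
    (1 - q powi (2 * int L)) * (1 - q powi (2 * int L + 1)) * (\<Sum>r<L. cubic_term L j (int r)) =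
    (\<Sum>r<L. cubic_certificate L j (int (Suc r)) - cubic_certificate L j (int r))"
    unfolding sum_distrib_left sum_subtractf[symmetric]
    by (rule sum.cong) (simp_all add: cubic_telescoping add.commute[of 1])
  \<comment> \<open>The certificate vanishes at r = 0 because -j - 1 < 0, and at r = L because L + 1
    - 3L < 0.\<close>
  also have "\<dots> = 0"
    unfolding sum_lessThan_telescope[of "\<lambda>r. cubic_certificate L j (int r)"]
    using assms by (simp add: cubic_certificate_def)
  \<comment> \<open>The extra term r = L of the longer sum is zero for the same reason.\<close>
  finally show ?thesis using assms by (simp add: cubic_term_def)
qed

lemma cubic_sum:
  assumes "0 \<le> j" "0 < L"
  shows "(\<Sum>r<L. cubic_term L j (int r)) =
    (q ^ 3) powi (j * j) * qfact q (2 * L - 1) * rqfact q (int L - 3 * j) * rqfact q (int L + 3 * j)"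
proof (cases "int L < 3 * j")
  case True
  have "cubic_term L j (int r) = 0" for r
    using True by (cases "int r < j") (simp_all add: cubic_term_def)
  then show ?thesis using True by simp
next
  case False
  \<comment> \<open>This is the first positive L with L \<ge> 3j, so the first at which the
    right-hand side is non-zero; the recurrence in L starts there.\<close>
  define L0 where "L0 = (if j = 0 then 1 else nat (3 * j))"
  have "L0 \<le> L" using False assms by (auto simp: L0_def)
  then show ?thesis
  proof (induction L rule: dec_induct)
    case base
    show ?case
    proof (cases "j = 0")
      case True
      then show ?thesis by (simp add: L0_def cubic_term_def rqfact_def qfact_Suc field_simps)
    next
      case False
      interpret cube: generic_base "q ^ 3" by (rule generic_base_cube)
      define i where "i = nat j - 1"
      have j: "j = int (Suc i)" using False assms by (simp add: i_def)
      have L0: "L0 = 3 * Suc i" using False j by (simp add: L0_def)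
      \<comment> \<open>At L = 3j only r = j survives: a smaller r makes r - j negative, a larger
        one makes L - 3r negative.\<close>
      have "(\<Sum>r<L0. cubic_term L0 j (int r)) = (\<Sum>r\<in>{Suc i}. cubic_term L0 j (int r))"
      proof (rule sum.mono_neutral_right)
        show "\<forall>r\<in>{..<L0} - {Suc i}. cubic_term L0 j (int r) = 0"
        proof
          fix r assume "r \<in> {..<L0} - {Suc i}"
          then have "r < Suc i \<or> L0 < 3 * r" using L0 by auto
          then show "cubic_term L0 j (int r) = 0" using L0 j by (auto simp: cubic_term_def)
        qed
      qed (use L0 in auto)
      also have "\<dots> = (q ^ 3) powi (j * j) * (qfact (q ^ 3) (2 * i + 1) * rqfact (q ^ 3) (int (2 * i + 2)))"
      proof -
        have "nat (int (3 * Suc i) - 1 - int (Suc i)) = 2 * i + 1" "int (Suc i) + int (Suc i) = int (2 * i + 2)"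
          "int (3 * Suc i) - 3 * int (Suc i) = 0" by simp_all
        then show ?thesis by (simp add: cubic_term_def j L0 rqfact_def[of _ 0])
      qed
      also have "qfact (q ^ 3) (2 * i + 1) * rqfact (q ^ 3) (int (2 * i + 2)) = inverse (1 - q ^ (6 * i + 6))"
      proof -
        have "(q ^ 3) ^ Suc (2 * i + 1) = q ^ (6 * i + 6)" unfolding power_mult[symmetric] by (simp add: add.commute)
        moreover have "2 * i + 2 = Suc (2 * i + 1)" by simp
        ultimately show ?thesis
          using cube.qfact_nonzero[of "2 * i + 1"] by (simp only: rqfact_of_nat qfact_Suc) simp
      qed
      also have "inverse (1 - q ^ (6 * i + 6)) = qfact q (6 * i + 5) * rqfact q (int (6 * i + 6))"
      proof -
        have "6 * i + 6 = Suc (6 * i + 5)" by simp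
        then show ?thesis
          using qfact_nonzero[of "6 * i + 5"] by (simp only: rqfact_of_nat qfact_Suc) simp
      qed
      finally have *: "(\<Sum>r<L0. cubic_term L0 j (int r)) =
        (q ^ 3) powi (j * j) * (qfact q (6 * i + 5) * rqfact q (int (6 * i + 6)))" .
      show ?thesis
      proof -
        have "2 * L0 - 1 = 6 * i + 5" "int L0 - 3 * j = 0" "int L0 + 3 * j = int (6 * i + 6)"
          using L0 j by simp_all
        then show ?thesis unfolding * by (simp add: rqfact_def[of _ 0] mult.assoc)
      qed
    qed
  next
    case (step L)
    have L: "0 < L" "3 * j \<le> int L" using step.hyps assms by (auto simp: L0_def split: if_splits)
    have ne: "1 - q powi m \<noteq> 0" if "0 < m" for m
      using not_root_of_unity[of "nat m"] that by (simp add: power_int_def)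
    let ?c = "(1 - q powi (int L + 1 - 3 * j)) * (1 - q powi (int L + 1 + 3 * j))"
    \<comment> \<open>Since L \<ge> 3j, both exponents are positive and the factor can be cancelled
      from the recurrence.\<close>
    have c: "?c \<noteq> 0" using ne L assms by simp
    have r: "rqfact q (int L - 3 * j) = (1 - q powi (int L + 1 - 3 * j)) * rqfact q (int (Suc L) - 3 * j)"
      "rqfact q (int L + 3 * j) = (1 - q powi (int L + 1 + 3 * j)) * rqfact q (int (Suc L) + 3 * j)"
      using rqfact_pred[of "int L + 1 - 3 * j"] rqfact_pred[of "int L + 1 + 3 * j"]
      by (simp_all add: algebra_simps)
    have f: "qfact q (2 * Suc L - 1) = qfact q (2 * L - 1) * (1 - q powi (2 * int L)) * (1 - q powi (2 * int L + 1))"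
    proof -
      have "2 * Suc L - 1 = Suc (2 * L)" by simp
      moreover have "qfact q (2 * L) = qfact q (2 * L - 1) * (1 - q ^ (2 * L))"
        using qfact_Suc[of q "2 * L - 1"] L by simp
      moreover have "q powi (2 * int L) = q ^ (2 * L)" "q powi (2 * int L + 1) = q ^ Suc (2 * L)"
        using power_int_of_nat[of q "2 * L"] power_int_of_nat[of q "Suc (2 * L)"] by (simp_all add: add.commute)
      ultimately show ?thesis by (simp only: qfact_Suc)
    qed
    have "?c * (\<Sum>r<Suc L. cubic_term (Suc L) j (int r)) = ?c * ((q ^ 3) powi (j * j) * qfact q (2 * Suc L - 1) *
        rqfact q (int (Suc L) - 3 * j) * rqfact q (int (Suc L) + 3 * j))"
      unfolding cubic_sum_Suc[OF assms(1) L(1)] step.IH f r by (simp only: mult_ac)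
    then show ?case using c by (simp only: mult_cancel_left) simp
  qed
qed

definition cubic_kernel :: "nat \<Rightarrow> nat \<Rightarrow> 'a" where
  "cubic_kernel L r = (q ^ 3) ^ (r * r) * (1 - q ^ (2 * L)) * qfact (q ^ 3) (L - 1 - r) *
     rqfact q (int L - 3 * int r) * rqfact (q ^ 3) (int (2 * r))"

text \<open>The factor 1 - q^(2L) of the kernel completes (q)_(2L-1) in \<open>cubic_sum\<close> to
  (q)_(2L). Both sides are even in x by symmetry of the binomials, so x \<ge> 0 suffices.\<close>

lemma cubic_transform:
  assumes "0 < L"
  shows "(\<Sum>r<L. cubic_kernel L r * gbinom (q ^ 3) (2 * r) (int r - x)) =
    q powi (3 * x\<^sup>2) * gbinom q (2 * L) (int L - 3 * x)"
proof -
  interpret cube: generic_base "q ^ 3" by (rule generic_base_cube)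
  have nonneg: "(\<Sum>r<L. cubic_kernel L r * gbinom (q ^ 3) (2 * r) (int r - x)) =
    q powi (3 * x\<^sup>2) * gbinom q (2 * L) (int L - 3 * x)" if "0 \<le> x" for x
  proof -
    have "cubic_kernel L r * gbinom (q ^ 3) (2 * r) (int r - x) = (1 - q ^ (2 * L)) * cubic_term L x (int r)"
      if "r < L" for r
    proof -
      have "nat (int L - 1 - int r) = L - 1 - r" "int (2 * r) - (int r - x) = int r + x"
        using that by auto
      moreover have "(q ^ 3) powi (int r * int r) = (q ^ 3) ^ (r * r)"
        by (metis of_nat_mult power_int_of_nat)
      ultimately show ?thesis
        using cube.qfact_rqfact[of "2 * r"]
        by (simp only: cubic_kernel_def cubic_term_def gbinom_def) (simp add: algebra_simps)
    qed
    then have "(\<Sum>r<L. cubic_kernel L r * gbinom (q ^ 3) (2 * r) (int r - x)) =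
      (1 - q ^ (2 * L)) * (\<Sum>r<L. cubic_term L x (int r))"
      by (simp add: sum_distrib_left)
    also have "\<dots> = (q ^ 3) powi (x * x) * (qfact q (2 * L - 1) * (1 - q ^ (2 * L))) *
      rqfact q (int L - 3 * x) * rqfact q (int L + 3 * x)"
      unfolding cubic_sum[OF that assms] by (simp only: mult_ac)
    also have "qfact q (2 * L - 1) * (1 - q ^ (2 * L)) = qfact q (2 * L)"
      using qfact_Suc[of q "2 * L - 1"] assms by simp
    also have "(q ^ 3) powi (x * x) = q powi (3 * x\<^sup>2)"
      unfolding power2_eq_square by (simp only: power_int_mult power_int_numeral)
    finally show ?thesis
      by (simp add: gbinom_def mult_ac diff_diff_eq2)
  qed
  show ?thesis
  proof (cases "0 \<le> x")
    case True
    then show ?thesis by (rule nonneg)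
  next
    case False
    have "gbinom (q ^ 3) (2 * r) (int r - x) = gbinom (q ^ 3) (2 * r) (int r - (- x))" for r
      using gbinom_sym[of "q ^ 3" "2 * r" "int r - x"] by simp
    moreover have "gbinom q (2 * L) (int L - 3 * x) = gbinom q (2 * L) (int L - 3 * (- x))"
      using gbinom_sym[of q "2 * L" "int L - 3 * x"] by simp
    ultimately show ?thesis using nonneg[of "- x"] False by simp
  qed
qed

end

section \<open>Laurent series with non-negative coefficients\<close>

text \<open>Laurent series over the rationals form a field, as \<open>generic_base\<close> requires,
  and admit the negative powers of q that occur on the way.\<close>

definition nonneg_fls :: "rat fls \<Rightarrow> bool" where
  "nonneg_fls f \<longleftrightarrow> (\<forall>n. 0 \<le> fls_nth f n)"

lemma nonneg_fls_0 [simp]: "nonneg_fls 0"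
  by (simp add: nonneg_fls_def)

lemma nonneg_fls_1 [simp]: "nonneg_fls 1"
  by (simp add: nonneg_fls_def)

lemma nonneg_fls_add: "nonneg_fls f \<Longrightarrow> nonneg_fls g \<Longrightarrow> nonneg_fls (f + g)"
  by (simp add: nonneg_fls_def)

lemma nonneg_fls_mult: "nonneg_fls f \<Longrightarrow> nonneg_fls g \<Longrightarrow> nonneg_fls (f * g)"
  by (simp add: nonneg_fls_def fls_times_nth(2) sum_nonneg)

lemma nonneg_fls_power: "nonneg_fls f \<Longrightarrow> nonneg_fls (f ^ n)"
  by (induction n) (simp_all add: nonneg_fls_mult)

lemma nonneg_fls_sum: "(\<And>i. i \<in> I \<Longrightarrow> nonneg_fls (f i)) \<Longrightarrow> nonneg_fls (sum f I)"
  by (induction I rule: infinite_finite_induct) (simp_all add: nonneg_fls_add)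

lemma nonneg_fls_prod: "(\<And>i. i \<in> I \<Longrightarrow> nonneg_fls (f i)) \<Longrightarrow> nonneg_fls (prod f I)"
  by (induction I rule: infinite_finite_induct) (simp_all add: nonneg_fls_mult)

text \<open>The common pattern of the two Pascal recurrences below: e and e' are the Pascal weights
  of the positive and the negative term, t is the power they share.\<close>

lemma diff_regroup:
  fixes a a' :: "'a::comm_ring"
  assumes "a * e = t * f" "a' * e' = t * f'"
  shows "a * (y + e * x) - a' * (y' + e' * x') = (a * y - a' * y') + t * (f * x - f' * x')"
proof -
  have "a * (e * x) = t * (f * x)" "a' * (e' * x') = t * (f' * x')"
    using assms by (simp_all flip: mult.assoc)
  then show ?thesis by (simp add: distrib_left right_diff_distrib)
qed

locale positive_base = generic_base q for q :: "rat fls" +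
  assumes nonneg: "nonneg_fls q" and nonneg_inverse: "nonneg_fls (inverse q)"
begin

lemma positive_base_cube: "positive_base (q ^ 3)"
proof -
  interpret cube: generic_base "q ^ 3" by (rule generic_base_cube)
  show ?thesis
    by unfold_locales (simp_all add: nonneg_fls_power nonneg nonneg_inverse flip: power_inverse)
qed

lemma nonneg_powi: "nonneg_fls (q powi n)"
  by (simp add: power_int_def nonneg_fls_power nonneg nonneg_inverse)

lemma nonneg_gbinom: "nonneg_fls (gbinom q m n)"
  by (induction m arbitrary: n)
    (simp_all add: gbinom_0_left gbinom_Suc nonneg_fls_add nonneg_fls_mult nonneg_powi)

section \<open>Positivity of the three kernels\<close>

lemma nonneg_quad_kernel: "nonneg_fls (quad_kernel L k)"
  by (auto simp: quad_kernel_def intro!: nonneg_fls_sum nonneg_fls_mult nonneg_powi nonneg_gbinom)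

lemma nonneg_odd_quad_kernel: "nonneg_fls (odd_quad_kernel L k)"
  by (auto simp: odd_quad_kernel_def intro!: nonneg_fls_sum nonneg_fls_mult nonneg_powi nonneg_gbinom)

text \<open>The kernel is not visibly positive as defined. The identity
  $1 - u^2 v = (1 - u^2) + u^2 (1 - v)$ splits it into two manifestly positive pieces.\<close>

lemma cubic_kernel_eq:
  assumes "L = 3 * r + Suc m"
  defines "u \<equiv> q ^ Suc m"
  shows "cubic_kernel L r = (q ^ 3) ^ (r * r) * (\<Prod>i<m. 1 + q ^ Suc i + (q ^ Suc i)\<^sup>2) *
    ((1 + u) * gbinom (q ^ 3) (m + 2 * r) (int (2 * r)) +
     u\<^sup>2 * (1 + u + u\<^sup>2) * gbinom (q ^ 3) (m + 2 * r) (int (2 * r) - 1))"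
proof -
  interpret cube: generic_base "q ^ 3" by (rule generic_base_cube)
  let ?P = "\<lambda>m. \<Prod>i<m. 1 + q ^ Suc i + (q ^ Suc i)\<^sup>2"
  define v where "v = q ^ (6 * r)"
  have PQ: "?P m * qfact q m = qfact (q ^ 3) m" for m
  proof (induction m)
    case (Suc m)
    have "(q ^ 3) ^ Suc m = (q ^ Suc m) ^ 3" by (simp only: power_mult[symmetric] mult.commute)
    moreover have "1 - x ^ 3 = (1 + x + x\<^sup>2) * (1 - x)" for x :: "rat fls"
      by (simp add: algebra_simps power2_eq_square power3_eq_cube)
    ultimately have "1 - (q ^ 3) ^ Suc m = (1 + q ^ Suc m + (q ^ Suc m)\<^sup>2) * (1 - q ^ Suc m)"
      by simp
    then show ?case using Suc.IH by (simp add: qfact_Suc del: power_Suc)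
  qed simp
  have u3: "(q ^ 3) ^ Suc m = u ^ 3" unfolding u_def by (simp only: power_mult[symmetric] mult.commute)
  have rq: "rqfact q (int (Suc m)) = ?P m * ((1 + u + u\<^sup>2) * rqfact (q ^ 3) (int (Suc m)))"
    using PQ[of "Suc m"] qfact_nonzero[of "Suc m"] cube.qfact_nonzero[of "Suc m"]
    unfolding rqfact_of_nat u_def by (simp add: field_simps del: power_Suc)
  have r1: "rqfact (q ^ 3) (int m) = (1 - u ^ 3) * rqfact (q ^ 3) (int (Suc m))"
    using cube.rqfact_pred[of "int (Suc m)"] unfolding power_int_of_nat u3 by simp
  have r2: "rqfact (q ^ 3) (int (2 * r) - 1) = (1 - v) * rqfact (q ^ 3) (int (2 * r))"
    using cube.rqfact_pred[of "int (2 * r)"] unfolding power_int_of_nat power_mult[symmetric] v_def by simp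
  have e: "L - 1 - r = m + 2 * r" "int L - 3 * int r = int (Suc m)" "int (m + 2 * r) - int (2 * r) = int m"
    "int (m + 2 * r) - (int (2 * r) - 1) = int (Suc m)" using assms by simp_all
  have uv: "q ^ (2 * L) = u\<^sup>2 * v"
    unfolding u_def v_def assms power_mult[symmetric] power_add[symmetric]
    by (rule arg_cong[where f = "\<lambda>k. q ^ k"]) simp
  \<comment> \<open>This is the splitting above multiplied by 1 + u + u^2, using (1 - u^2)(1 + u +
    u^2) = (1 + u)(1 - u^3).\<close>
  have alg: "(1 + u) * (1 - u ^ 3) + u\<^sup>2 * (1 + u + u\<^sup>2) * (1 - v) = (1 - u\<^sup>2 * v) * (1 + u + u\<^sup>2)"
    by (simp add: algebra_simps power2_eq_square power3_eq_cube)
  have scale: "z * (1 - w) * F * (P * (t * x)) * y = z * P * (a * (F * y * (b * x)) + d * (F * (c * y) * x))"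
    if "a * b + d * c = (1 - w) * t" for z w F P t x y a b c d :: "rat fls"
    using arg_cong[OF that, of "\<lambda>s. s * (z * F * P * x * y)"] by (simp add: algebra_simps)
  show ?thesis
    unfolding cubic_kernel_def gbinom_def e rq r1 r2 uv by (rule scale[OF alg])
qed

text \<open>The kernel is zero for L < 3r and a single power of q for L = 3r, where its factorials
  cancel. For L > 3r the preceding formula is manifestly positive.\<close>

lemma nonneg_cubic_kernel:
  assumes "r < L"
  shows "nonneg_fls (cubic_kernel L r)"
proof -
  interpret cube: positive_base "q ^ 3" by (rule positive_base_cube)
  consider "L < 3 * r" | "L = 3 * r" | m where "L = 3 * r + Suc m"
    by (metis less_imp_Suc_add linorder_neqE_nat add_Suc_right)
  then show ?thesis
  proof cases
    case 1
    then show ?thesis by (simp add: cubic_kernel_def)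
  next
    case 2
    have "(q ^ 3) ^ (2 * r) = q ^ (2 * L)" "L - 1 - r = 2 * r - 1" "Suc (2 * r - 1) = 2 * r"
      unfolding power_mult[symmetric] using 2 assms by auto
    then have "cubic_kernel L r = (q ^ 3) ^ (r * r) * (qfact (q ^ 3) (2 * r) * rqfact (q ^ 3) (int (2 * r)))"
      using qfact_Suc[of "q ^ 3" "2 * r - 1"] 2
      by (simp only: cubic_kernel_def) (simp add: rqfact_def mult_ac)
    then show ?thesis
      by (simp only: cube.qfact_rqfact) (simp add: nonneg_fls_power nonneg)
  next
    case 3
    show ?thesis
      unfolding cubic_kernel_eq[OF 3]
      by (intro nonneg_fls_mult nonneg_fls_add nonneg_fls_prod nonneg_fls_power cube.nonneg_gbinom
          nonneg nonneg_fls_1)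
  qed
qed

section \<open>The alternating sums and their Pascal recurrences\<close>

text \<open>\<open>hook_sum\<close> is $D_{K,i}(N, M; p - b, b)$, with the sum truncated to \<open>\<bar>j\<bar> \<le> B\<close>.\<close>

definition hook_sum :: "int \<Rightarrow> int \<Rightarrow> int \<Rightarrow> int \<Rightarrow> int \<Rightarrow> int \<Rightarrow> int \<Rightarrow> rat fls" where
  "hook_sum K i p B b M N = (\<Sum>j=-B..B.
     q powi (j * (p * K * j + K * b - p * i)) * gbinom q (nat (M + N)) (M - K * j) -
     q powi ((p * j + b) * (K * j + i)) * gbinom q (nat (M + N)) (M - K * j - i))"

text \<open>The Pascal weights q^(M-Kj) and q^(M-Kj-i) shift both exponents to those for b - 1 at
  the same cost q^M, so the family is closed under the rule. In the second recurrence the weights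
  q^(N+Kj) and q^(N+Kj+i) raise b instead, at cost q^N.\<close>

lemma hook_sum_rec1:
  assumes "nat (M + N) = Suc n"
  shows "hook_sum K i p B b M N = hook_sum K i p B b (M - 1) N + q powi M * hook_sum K i p B (b - 1) M (N - 1)"
proof -
  have n: "nat (M - 1 + N) = n" "nat (M + (N - 1)) = n" using assms by linarith+
  have 1: "q powi (j * (p * K * j + K * b - p * i)) * q powi (M - K * j) =
      q powi M * q powi (j * (p * K * j + K * (b - 1) - p * i))" for j
    unfolding powi_add[symmetric] by (rule arg_cong[where f = "\<lambda>k. q powi k"]) (simp add: algebra_simps)
  have 2: "q powi ((p * j + b) * (K * j + i)) * q powi (M - K * j - i) =
      q powi M * q powi ((p * j + (b - 1)) * (K * j + i))" for j
    unfolding powi_add[symmetric] by (rule arg_cong[where f = "\<lambda>k. q powi k"]) (simp add: algebra_simps)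
  have 3: "M - K * j - 1 = M - 1 - K * j" "M - K * j - i - 1 = M - 1 - K * j - i" for j by simp_all
  show ?thesis
    unfolding hook_sum_def assms n gbinom_Suc sum_distrib_left sum.distrib[symmetric] 3
    by (rule sum.cong[OF refl], subst (1 2) add.commute[of "_ * _"], rule diff_regroup[OF 1 2])
qed

lemma hook_sum_rec2:
  assumes "nat (M + N) = Suc n"
  shows "hook_sum K i p B b M N = hook_sum K i p B b M (N - 1) + q powi N * hook_sum K i p B (b + 1) (M - 1) N"
proof -
  have n: "nat (M - 1 + N) = n" "nat (M + (N - 1)) = n" "int n + 1 = M + N" using assms by linarith+
  have 1: "q powi (j * (p * K * j + K * b - p * i)) * q powi (M + N - (M - K * j)) =
      q powi N * q powi (j * (p * K * j + K * (b + 1) - p * i))" for j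
    unfolding powi_add[symmetric] by (rule arg_cong[where f = "\<lambda>k. q powi k"]) (simp add: algebra_simps)
  have 2: "q powi ((p * j + b) * (K * j + i)) * q powi (M + N - (M - K * j - i)) =
      q powi N * q powi ((p * j + (b + 1)) * (K * j + i))" for j
    unfolding powi_add[symmetric] by (rule arg_cong[where f = "\<lambda>k. q powi k"]) (simp add: algebra_simps)
  have 3: "M - K * j - 1 = M - 1 - K * j" "M - K * j - i - 1 = M - 1 - K * j - i" for j by simp_all
  show ?thesis
    unfolding hook_sum_def assms n gbinom_Suc' sum_distrib_left sum.distrib[symmetric] 3
    by (rule sum.cong[OF refl], rule diff_regroup[OF 1 2])
qed

text \<open>Reflecting j to -j, together with the symmetry of the binomials, exchanges the positive
  and the negative terms.\<close>

lemma hook_sum_lower_edge: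
  assumes "N - M = - i" "0 \<le> M + N"
  shows "hook_sum K i p B 0 M N = 0"
proof -
  have "(\<Sum>j=-B..B. q powi ((p * j + 0) * (K * j + i)) * gbinom q (nat (M + N)) (M - K * j - i)) =
    (\<Sum>j=-B..B. q powi (j * (p * K * j + K * 0 - p * i)) * gbinom q (nat (M + N)) (M - K * j))"
  proof (rule sum.reindex_bij_witness[where i = uminus and j = uminus])
    fix j :: int
    have "M - K * - j = int (nat (M + N)) - (M - K * j - i)" using assms by simp
    moreover have "- j * (p * K * - j + K * 0 - p * i) = (p * j + 0) * (K * j + i)" by (simp add: algebra_simps)
    ultimately show "q powi (- j * (p * K * - j + K * 0 - p * i)) * gbinom q (nat (M + N)) (M - K * - j) =
        q powi ((p * j + 0) * (K * j + i)) * gbinom q (nat (M + N)) (M - K * j - i)"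
      by (simp only: gbinom_sym)
  qed auto
  then show ?thesis by (simp add: hook_sum_def sum_subtractf)
qed

text \<open>Here the exchange is j to -1 - j. It preserves the window -B..B-1 but not -B..B, so the
  terms j = B are first removed; they vanish because M < K B.\<close>

lemma hook_sum_upper_edge:
  assumes "N - M = K - i" "0 \<le> M + N" "0 < K" "0 \<le> i" "M < B" "0 \<le> B"
  shows "hook_sum K i p B p M N = 0"
proof -
  have "B \<le> K * B" using assms(3,6) mult_right_mono[of 1 K B] by simp
  then have neg: "M - K * B < 0" using assms(5) by linarith
  have "(\<Sum>j=-B..B. q powi ((p * j + p) * (K * j + i)) * gbinom q (nat (M + N)) (M - K * j - i)) =
    (\<Sum>j\<in>{-B..B-1}. q powi ((p * j + p) * (K * j + i)) * gbinom q (nat (M + N)) (M - K * j - i))"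
  proof (rule sum.mono_neutral_right)
    show "\<forall>j\<in>{-B..B} - {-B..B-1}. q powi ((p * j + p) * (K * j + i)) * gbinom q (nat (M + N)) (M - K * j - i) = 0"
    proof
      fix j assume "j \<in> {-B..B} - {-B..B-1}"
      then have "j = B" by auto
      then show "q powi ((p * j + p) * (K * j + i)) * gbinom q (nat (M + N)) (M - K * j - i) = 0"
        using neg assms(4) by (simp add: gbinom_eq_0)
    qed
  qed auto
  also have "\<dots> = (\<Sum>j\<in>{-B..B-1}. q powi (j * (p * K * j + K * p - p * i)) * gbinom q (nat (M + N)) (M - K * j))"
  proof (rule sum.reindex_bij_witness[where i = "\<lambda>j. - 1 - j" and j = "\<lambda>j. - 1 - j"])
    fix j :: int
    have "M - K * (- 1 - j) = int (nat (M + N)) - (M - K * j - i)" using assms by (simp add: algebra_simps)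
    moreover have "(- 1 - j) * (p * K * (- 1 - j) + K * p - p * i) = (p * j + p) * (K * j + i)"
      by (simp add: algebra_simps)
    ultimately show "q powi ((- 1 - j) * (p * K * (- 1 - j) + K * p - p * i)) * gbinom q (nat (M + N)) (M - K * (- 1 - j)) =
        q powi ((p * j + p) * (K * j + i)) * gbinom q (nat (M + N)) (M - K * j - i)"
      by (simp only: gbinom_sym)
  qed auto
  also have "\<dots> = (\<Sum>j=-B..B. q powi (j * (p * K * j + K * p - p * i)) * gbinom q (nat (M + N)) (M - K * j))"
  proof (rule sum.mono_neutral_left)
    show "\<forall>j\<in>{-B..B} - {-B..B-1}. q powi (j * (p * K * j + K * p - p * i)) * gbinom q (nat (M + N)) (M - K * j) = 0"
    proof
      fix j assume "j \<in> {-B..B} - {-B..B-1}"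
      then have "j = B" by auto
      then show "q powi (j * (p * K * j + K * p - p * i)) * gbinom q (nat (M + N)) (M - K * j) = 0"
        using neg by (simp add: gbinom_eq_0)
    qed
  qed auto
  finally show ?thesis by (simp add: hook_sum_def sum_subtractf)
qed

text \<open>Each term of the first Pascal recurrence raises \<open>N - M - b\<close> or lowers \<open>b\<close> by one, each term of
  the second does the opposite. So one of them respects the bounds, except at the two corners where
  the sum vanishes.\<close>

lemma nonneg_hook_sum:
  assumes "0 < p" "p < K" "0 < i" "i < K" "0 \<le> B" "0 \<le> b" "b \<le> p"
    and "b - i \<le> N - M" "N - M \<le> K - p + b - i" "0 \<le> M + N" "M < B"
  shows "nonneg_fls (hook_sum K i p B b M N)"
  using assms(6-)
proof (induction "nat (M + N)" arbitrary: M N b)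
  case 0
  have N: "N = - M" using 0 by simp
  \<comment> \<open>When M + N = 0 the bounds on N - M = -2M give -(K - i) < M < i, whereas K j + i
    is at least i or at most i - K. So no negative term survives.\<close>
  have "M - K * j - i \<noteq> 0" for j
  proof
    assume M: "M - K * j - i = 0"
    show False
    proof (cases "0 \<le> j")
      case True
      then have "0 \<le> K * j" using assms by simp
      then show False using M N 0 assms by linarith
    next
      case False
      then have "K * j \<le> K * (- 1)" using assms by (intro mult_left_mono) auto
      then show False using M N 0 assms by linarith
    qed
  qed
  then have "nonneg_fls (q powi (j * (p * K * j + K * b - p * i)) * gbinom q (nat (M + N)) (M - K * j) -
     q powi ((p * j + b) * (K * j + i)) * gbinom q (nat (M + N)) (M - K * j - i))" for j
    using 0(1) by (simp add: gbinom_0_left nonneg_powi)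
  then show ?case unfolding hook_sum_def by (intro nonneg_fls_sum)
next
  case (Suc n)
  note bounds = Suc.prems assms(1-5)
  have n: "nat (M + N) = Suc n" using Suc by simp
  have n': "n = nat (M - 1 + N)" "n = nat (M + (N - 1))" using n by linarith+
  consider "b = 0" "N - M = - i" | "b = p" "N - M = K - i"
    | "0 < b" "N - M < K - p + b - i" | "b < p" "b - i < N - M"
    using bounds by linarith
  then show ?case
  proof cases
    case 1
    then show ?thesis using hook_sum_lower_edge Suc.prems by simp
  next
    case 2
    then show ?thesis using hook_sum_upper_edge bounds by simp
  next
    case 3
    have "nonneg_fls (hook_sum K i p B b (M - 1) N)"
      by (rule Suc.hyps(1)[OF n'(1)]) (use 3 bounds n in linarith)+
    moreover have "nonneg_fls (hook_sum K i p B (b - 1) M (N - 1))"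
      by (rule Suc.hyps(1)[OF n'(2)]) (use 3 bounds n in linarith)+
    ultimately show ?thesis
      unfolding hook_sum_rec1[OF n] by (intro nonneg_fls_add nonneg_fls_mult nonneg_powi)
  next
    case 4
    have "nonneg_fls (hook_sum K i p B b M (N - 1))"
      by (rule Suc.hyps(1)[OF n'(2)]) (use 4 bounds n in linarith)+
    moreover have "nonneg_fls (hook_sum K i p B (b + 1) (M - 1) N)"
      by (rule Suc.hyps(1)[OF n'(1)]) (use 4 bounds n in linarith)+
    ultimately show ?thesis
      unfolding hook_sum_rec2[OF n] by (intro nonneg_fls_add nonneg_fls_mult nonneg_powi)
  qed
qed

end

section \<open>Transporting positivity through the transformations\<close>

locale hook_data =
  fixes p p' r s B :: int
  assumes r_pos: "0 < r" and r_less: "r < p" and p_less: "p < p'"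
    and s_pos: "0 < s" and s_less: "s < p'" and B_nonneg: "0 \<le> B"
begin

text \<open>The index \<open>(True, j)\<close> stands for the \<open>j\<close>-th positive term and \<open>(False, j)\<close> for the \<open>j\<close>-th
  negative term of $D$. Every transformation multiplies the half-width \<open>2 * offset + 1\<close> of the
  $q$-binomial by 2 or 3 and adds a multiple of its square to the exponent; \<open>gain\<close> is that
  square up to a factor 8 and an additive constant, which does not affect positivity.\<close>

definition term_sign :: "bool \<times> int \<Rightarrow> rat fls" where
  "term_sign = (\<lambda>(\<sigma>, j). if \<sigma> then 1 else - 1)"

definition expo :: "bool \<times> int \<Rightarrow> int" where
  "expo = (\<lambda>(\<sigma>, j). if \<sigma> then j * (p * p' * j + p' * r - p * s) else (p * j + r) * (p' * j + s))"

definition offset :: "bool \<times> int \<Rightarrow> int" where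
  "offset = (\<lambda>(\<sigma>, j). 2 * p' * j + r + (if \<sigma> then - s else s))"

definition gain :: "bool \<times> int \<Rightarrow> int" where
  "gain = (\<lambda>(\<sigma>, j). if \<sigma> then p' * j * (2 * p' * j + 2 * (r - s) + 1) else (p' * j + s) * (2 * p' * j + 2 * r + 1))"

definition family_sum :: "rat fls \<Rightarrow> (bool \<times> int \<Rightarrow> int) \<Rightarrow> (bool \<times> int \<Rightarrow> rat fls) \<Rightarrow> rat fls" where
  "family_sum q E G = (\<Sum>i\<in>UNIV \<times> {-B..B}. term_sign i * (q powi E i * G i))"

lemma family_sum_split: "family_sum q E G = (\<Sum>j=-B..B. q powi E (True, j) * G (True, j) - q powi E (False, j) * G (False, j))"
  by (simp add: family_sum_def term_sign_def sum.cartesian_product' UNIV_bool sum_subtractf sum_negf)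

text \<open>The difference from \<open>gain\<close> does not depend on the index, so replacing one
  by the other costs a single global power of q. The same applies to
  \<open>square_offset\<close>.\<close>

lemma offset_square: "offset i * (offset i + 1) div 2 = gain i + (r - s) * (r - s + 1) div 2"
proof -
  have "offset i * (offset i + 1) = 2 * gain i + (r - s) * (r - s + 1)"
    by (auto simp: offset_def gain_def algebra_simps split: prod.split)
  then show ?thesis by simp
qed

lemma square_offset: "(2 * offset i + 1)\<^sup>2 = 8 * gain i + (2 * (r - s) + 1)\<^sup>2"
  by (auto simp: offset_def gain_def algebra_simps power2_eq_square split: prod.split)

lemma family_sum_eq_hook_sum:
  assumes "positive_base q" "0 \<le> k"
  shows "family_sum q expo (\<lambda>i. gbinom q (nat k) ((k - offset i) div 2)) =
    positive_base.hook_sum q p' s p B r ((k - r + s) div 2) (k - (k - r + s) div 2)"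
proof -
  interpret positive_base q by (rule assms)
  have "(k - (2 * p' * j + r - s)) div 2 = (k - r + s) div 2 - p' * j"
    "(k - (2 * p' * j + r + s)) div 2 = (k - r + s) div 2 - p' * j - s" for j
  proof -
    have "k - (2 * p' * j + r - s) = k - r + s + (- (p' * j)) * 2"
      "k - (2 * p' * j + r + s) = k - r + s + (- (p' * j) - s) * 2" by simp_all
    then show "(k - (2 * p' * j + r - s)) div 2 = (k - r + s) div 2 - p' * j"
      "(k - (2 * p' * j + r + s)) div 2 = (k - r + s) div 2 - p' * j - s"
      by (simp_all only: div_mult_self1 zero_neq_numeral simp_thms)
  qed
  then show ?thesis
    by (simp add: family_sum_split hook_sum_def expo_def offset_def)
qed

text \<open>Here N - M is r - s or r - s + 1 according to the parity of k - r + s. Both values are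
  admissible for b = r because p' - p \<ge> 1.\<close>

lemma nonneg_level_0:
  assumes "positive_base q" "0 \<le> k" "k + s < B"
  shows "nonneg_fls (family_sum q expo (\<lambda>i. gbinom q (nat k) ((k - offset i) div 2)))"
proof -
  interpret positive_base q by (rule assms)
  have "(k - r + s) div 2 < B" "r - s \<le> k - (k - r + s) div 2 - (k - r + s) div 2"
    "k - (k - r + s) div 2 - (k - r + s) div 2 \<le> r - s + 1"
    using assms r_pos s_pos by linarith+
  then show ?thesis
    unfolding family_sum_eq_hook_sum[OF assms(1,2)]
    by (intro nonneg_hook_sum) (use assms r_pos r_less p_less s_pos s_less B_nonneg in linarith)+
qed

text \<open>A termwise identity with an index-free positive kernel writes the new sum as a positive
  combination of old ones; the exponent t joins E, and c is a global shift.\<close>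

lemma family_sum_step:
  assumes "positive_base q"
    and transform: "\<And>i. (\<Sum>k\<in>S. \<kappa> k * H k i) = q powi t i * G i"
    and "\<And>k. k \<in> S \<Longrightarrow> nonneg_fls (\<kappa> k)"
    and "\<And>k. k \<in> S \<Longrightarrow> nonneg_fls (family_sum q E (H k))"
    and E': "\<And>i. E' i = E i + t i + c"
  shows "nonneg_fls (family_sum q E' G)"
proof -
  interpret positive_base q by (rule assms)
  have "family_sum q E' G = (\<Sum>i\<in>UNIV \<times> {-B..B}. q powi c * (term_sign i * (q powi E i * (q powi t i * G i))))"
    unfolding family_sum_def E' powi_add by (simp only: mult_ac)
  also have "\<dots> = (\<Sum>i\<in>UNIV \<times> {-B..B}. \<Sum>k\<in>S. q powi c * (\<kappa> k * (term_sign i * (q powi E i * H k i))))"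
    unfolding transform[symmetric] sum_distrib_left by (simp only: mult_ac)
  also have "\<dots> = q powi c * (\<Sum>k\<in>S. \<kappa> k * family_sum q E (H k))"
    unfolding family_sum_def by (subst sum.swap) (simp only: sum_distrib_left)
  finally show ?thesis
    using assms by (simp add: nonneg_fls_mult nonneg_fls_sum nonneg_powi)
qed

lemma nonneg_level_1:
  assumes "positive_base q" "int L + s < B"
  shows "nonneg_fls (family_sum q (\<lambda>i. expo i + gain i) (\<lambda>i. gbinom q (2 * L + 1) (int L - offset i)))"
proof -
  interpret positive_base q by (rule assms)
  show ?thesis
  proof (rule family_sum_step[OF assms(1) odd_quad_transform])
    show "nonneg_fls (family_sum q expo (\<lambda>i. gbinom q (nat k) ((k - offset i) div 2)))" if "k \<in> {0..int L}" for k
      by (rule nonneg_level_0) (use assms that in auto)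
    show "expo i + gain i = expo i + offset i * (offset i + 1) div 2 + - ((r - s) * (r - s + 1) div 2)" for i
      unfolding offset_square by simp
  qed (rule nonneg_odd_quad_kernel)
qed

text \<open>The argument 2 * \<open>offset\<close> + 1 is odd, so only odd k = 2m + 1 contribute,
  and these are level 1 sums. Half of its square adds 4 * \<open>gain\<close>, hence the coefficient
  5.\<close>

lemma nonneg_level_2:
  assumes "positive_base q" "int L + s < B"
  shows "nonneg_fls (family_sum q (\<lambda>i. expo i + 5 * gain i) (\<lambda>i. gbinom q (2 * L) (int L - (2 * offset i + 1))))"
proof -
  interpret positive_base q by (rule assms)
  show ?thesis
  proof (rule family_sum_step[OF assms(1) quad_transform])
    show "nonneg_fls (family_sum q (\<lambda>i. expo i + gain i)
        (\<lambda>i. if even (k - (2 * offset i + 1)) then gbinom q (nat k) ((k - (2 * offset i + 1)) div 2) else 0))"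
      if k: "k \<in> {0..int L}" for k
    proof (cases "even k")
      case True
      then show ?thesis by (simp add: family_sum_def)
    next
      case False
      define m where "m = nat (k div 2)"
      have m: "k = 2 * int m + 1" using False k by (simp add: m_def)
      have "nat k = 2 * m + 1" "(k - (2 * offset i + 1)) div 2 = int m - offset i" "even (k - (2 * offset i + 1))" for i
        using m by auto
      then show ?thesis using nonneg_level_1[OF assms(1), of m] assms(2) k m by simp
    qed
    show "expo i + 5 * gain i = expo i + gain i + (2 * offset i + 1)\<^sup>2 div 2 + - ((2 * (r - s) + 1)\<^sup>2 div 2)" for i
      unfolding square_offset by simp
  qed (rule nonneg_quad_kernel)
qed

lemma nonneg_quad_step:
  assumes "positive_base q"
    and "\<And>m. m \<le> L \<Longrightarrow> nonneg_fls (family_sum q E (\<lambda>i. gbinom q (2 * m) (int m - X i)))"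
    and "\<And>i. E' i = E i + 2 * (X i)\<^sup>2 + c"
  shows "nonneg_fls (family_sum q E' (\<lambda>i. gbinom q (2 * L) (int L - 2 * X i)))"
proof -
  interpret positive_base q by (rule assms)
  show ?thesis
  proof (rule family_sum_step[OF assms(1) quad_transform])
    show "nonneg_fls (family_sum q E
        (\<lambda>i. if even (k - 2 * X i) then gbinom q (nat k) ((k - 2 * X i) div 2) else 0))"
      if k: "k \<in> {0..int L}" for k
    proof (cases "even k")
      case False
      then show ?thesis by (simp add: family_sum_def)
    next
      case True
      define m where "m = nat (k div 2)"
      have m: "k = 2 * int m" using True k by (simp add: m_def)
      then have "nat k = 2 * m" "(k - 2 * X i) div 2 = int m - X i" "even (k - 2 * X i)" for i by auto
      then show ?thesis using assms(2)[of m] k m by simp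
    qed
    show "E' i = E i + (2 * X i)\<^sup>2 div 2 + c" for i
      by (simp add: assms(3) power_mult_distrib)
  qed (rule nonneg_quad_kernel)
qed

text \<open>The coefficient is 1 + 4 + ... + 4^(m+1): doubling 2^m (2 * \<open>offset\<close> + 1)
  adds 4^(m+2) * \<open>gain\<close>.\<close>

lemma nonneg_level:
  assumes "positive_base q" "int L + s < B"
  shows "nonneg_fls (family_sum q (\<lambda>i. expo i + (4 ^ (m + 2) - 1) div 3 * gain i)
    (\<lambda>i. gbinom q (2 * L) (int L - 2 ^ m * (2 * offset i + 1))))"
  using assms(2)
proof (induction m arbitrary: L)
  case 0
  then show ?case using nonneg_level_2[OF assms(1)] by simp
next
  case (Suc m)
  have "nonneg_fls (family_sum q (\<lambda>i. expo i + (4 ^ (Suc m + 2) - 1) div 3 * gain i)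
    (\<lambda>i. gbinom q (2 * L) (int L - 2 * (2 ^ m * (2 * offset i + 1)))))"
  proof (rule nonneg_quad_step[OF assms(1)])
    show "nonneg_fls (family_sum q (\<lambda>i. expo i + (4 ^ (m + 2) - 1) div 3 * gain i)
        (\<lambda>i. gbinom q (2 * l) (int l - 2 ^ m * (2 * offset i + 1))))" if "l \<le> L" for l
      using Suc that by simp
    have "(4 ^ (Suc m + 2) - 1 :: int) div 3 = (4 ^ (m + 2) - 1) div 3 + 4 ^ (m + 2)"
    proof -
      have "(4 ^ (Suc m + 2) - 1 :: int) = (4 ^ (m + 2) - 1) + 4 ^ (m + 2) * 3" by simp
      then show ?thesis by (simp only: div_mult_self1 zero_neq_numeral simp_thms)
    qed
    moreover have "(2 ^ m)\<^sup>2 = (4 ^ m :: int)" by (simp add: power2_eq_square flip: power_mult_distrib)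
    ultimately show "expo i + (4 ^ (Suc m + 2) - 1) div 3 * gain i = expo i + (4 ^ (m + 2) - 1) div 3 * gain i +
        2 * (2 ^ m * (2 * offset i + 1))\<^sup>2 + - (2 * 4 ^ m * (2 * (r - s) + 1)\<^sup>2)" for i
      unfolding power_mult_distrib square_offset by (simp add: algebra_simps)
  qed
  then show ?case by (simp add: mult.assoc)
qed

text \<open>Positivity is assumed for every base because it is used at \<open>q ^ 3\<close>;
  rewriting that sum in base q triples E. For L = 0, outside the scope of
  \<open>cubic_transform\<close>, only X = 0 contributes.\<close>

lemma nonneg_cubic_step:
  assumes q: "positive_base q"
    and prev: "\<And>q l. positive_base q \<Longrightarrow> l \<le> L \<Longrightarrow> nonneg_fls (family_sum q E (\<lambda>i. gbinom q (2 * l) (int l - X i)))"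
    and E': "\<And>i. E' i = 3 * E i + 3 * (X i)\<^sup>2 + c"
  shows "nonneg_fls (family_sum q E' (\<lambda>i. gbinom q (2 * L) (int L - 3 * X i)))"
proof -
  interpret positive_base q by (rule q)
  have cube: "family_sum (q ^ 3) E G = family_sum q (\<lambda>i. 3 * E i) G" for G
    by (simp add: family_sum_def power_int_mult)
  have prev': "nonneg_fls (family_sum q (\<lambda>i. 3 * E i) (\<lambda>i. gbinom (q ^ 3) (2 * l) (int l - X i)))" if "l \<le> L" for l
    using prev[OF positive_base_cube that] by (simp only: cube)
  show ?thesis
  proof (cases "L = 0")
    case True
    have "(\<Sum>l\<in>{0::nat}. 1 * gbinom (q ^ 3) 0 (int l - X i)) = q powi (3 * (X i)\<^sup>2) * gbinom q (2 * L) (int L - 3 * X i)" for i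
      using True by (simp add: gbinom_0_left)
    then show ?thesis
      by (rule family_sum_step[OF q _ _ _ E']) (use prev'[of 0] in simp_all)
  next
    case False
    show ?thesis
    proof (rule family_sum_step[OF q cubic_transform _ _ E'])
      show "0 < L" using False by simp
    qed (use nonneg_cubic_kernel prev' in auto)
  qed
qed

text \<open>With 3^t factored out, the cubic step from t to t + 1 adds 2 * 3^t * 4^(m+1) to the
  coefficient of \<open>gain\<close>; these increments sum to 4^(m+1) (3^t - 1).\<close>

lemma nonneg_family:
  assumes "positive_base q" "int L + s < B"
  shows "nonneg_fls (family_sum q (\<lambda>i. 3 ^ t * (expo i + ((4 ^ (m + 2) - 1) div 3 + 4 ^ (m + 1) * (3 ^ t - 1)) * gain i))
    (\<lambda>i. gbinom q (2 * L) (int L - 3 ^ t * 2 ^ m * (2 * offset i + 1))))"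
  using assms
proof (induction t arbitrary: L q)
  case 0
  then show ?case using nonneg_level[OF 0, of m] by simp
next
  case (Suc t)
  let ?E = "\<lambda>t i. 3 ^ t * (expo i + ((4 ^ (m + 2) - 1) div 3 + 4 ^ (m + 1) * (3 ^ t - 1)) * gain i)"
  have "nonneg_fls (family_sum q (?E (Suc t)) (\<lambda>i. gbinom q (2 * L) (int L - 3 * (3 ^ t * 2 ^ m * (2 * offset i + 1)))))"
  proof (rule nonneg_cubic_step[OF Suc.prems(1)])
    show "nonneg_fls (family_sum q (?E t) (\<lambda>i. gbinom q (2 * l) (int l - 3 ^ t * 2 ^ m * (2 * offset i + 1))))"
      if "positive_base q" "l \<le> L" for q l
      using Suc that by simp
    have "(3 ^ t * 2 ^ m)\<^sup>2 = (3 ^ t * (3 ^ t * 4 ^ m) :: int)"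
      by (simp add: power2_eq_square flip: power_mult_distrib)
    then show "?E (Suc t) i = 3 * ?E t i + 3 * (3 ^ t * 2 ^ m * (2 * offset i + 1))\<^sup>2
        + - (3 * (3 ^ t * (3 ^ t * 4 ^ m)) * (2 * (r - s) + 1)\<^sup>2)" for i
      unfolding power_mult_distrib[of "3 ^ t * 2 ^ m"] square_offset by (simp add: algebra_simps)
  qed
  then show ?case by (simp add: mult.assoc)
qed

end

section \<open>Back to integer polynomials\<close>

text \<open>A division-free intermediary: it obeys the same Pascal rule as \<open>gbinom\<close> and
  satisfies the product formula that makes the division in \<open>qbinom\<close> exact.\<close>

fun gauss_poly :: "nat \<Rightarrow> nat \<Rightarrow> int poly" where
  "gauss_poly 0 n = (if n = 0 then 1 else 0)"
| "gauss_poly (Suc m) 0 = 1"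
| "gauss_poly (Suc m) (Suc n) = monom 1 (Suc n) * gauss_poly m (Suc n) + gauss_poly m n"

lemma qpoch_Suc: "qpoch (Suc n) = qpoch n * (1 - monom 1 (Suc n))"
  by (simp add: qpoch_def)

lemma qpoch_nonzero: "qpoch n \<noteq> 0"
proof (induction n)
  case (Suc n)
  have "coeff (1 - monom 1 (Suc n) :: int poly) 0 \<noteq> 0" by simp
  then have "1 - monom 1 (Suc n) \<noteq> (0 :: int poly)" by fastforce
  then show ?case using Suc by (simp add: qpoch_Suc)
qed (simp add: qpoch_def)

lemma gauss_poly_eq_0: "m < n \<Longrightarrow> gauss_poly m n = 0"
  by (induction m n rule: gauss_poly.induct) auto

lemma gauss_poly_qpoch: "n \<le> m \<Longrightarrow> gauss_poly m n * (qpoch n * qpoch (m - n)) = qpoch m"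
proof (induction m n rule: gauss_poly.induct)
  case (3 m n)
  let ?x = "monom 1 :: nat \<Rightarrow> int poly"
  have a: "gauss_poly m n * (qpoch (Suc n) * qpoch (m - n)) = qpoch m * (1 - ?x (Suc n))"
    using 3 by (simp add: qpoch_Suc mult_ac flip: 3(2))
  have b: "gauss_poly m (Suc n) * (qpoch (Suc n) * qpoch (m - n)) = qpoch m * (1 - ?x (m - n))"
  proof (cases "n = m")
    \<comment> \<open>Both sides are zero: the binomial is out of range and 1 - x^0 = 0.\<close>
    case True
    then show ?thesis by (simp add: gauss_poly_eq_0 one_pCons monom_0)
  next
    case False
    then have "m - n = Suc (m - Suc n)" "Suc n \<le> m" using 3 by auto
    then show ?thesis using 3(1) by (simp add: qpoch_Suc mult_ac)
  qed
  have "gauss_poly (Suc m) (Suc n) * (qpoch (Suc n) * qpoch (Suc m - Suc n)) =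
    ?x (Suc n) * (qpoch m * (1 - ?x (m - n))) + qpoch m * (1 - ?x (Suc n))"
    unfolding a[symmetric] b[symmetric] by (simp add: algebra_simps)
  also have "\<dots> = qpoch m * (1 - ?x (Suc n) * ?x (m - n))"
    by (simp add: algebra_simps)
  also have "?x (Suc n) * ?x (m - n) = ?x (Suc m)"
    using 3 by (simp add: mult_monom)
  finally show ?case by (simp add: qpoch_Suc)
qed (simp_all add: qpoch_def)

lemma qbinom_eq_gauss_poly: "qbinom (int m) (int n) = gauss_poly m n"
proof (cases "n \<le> m")
  case True
  then have "nat (int m - int n) = m - n" by simp
  then show ?thesis
    using True qpoch_nonzero gauss_poly_qpoch[OF True]
    by (simp add: qbinom_def) (metis mult_eq_0_iff nonzero_mult_div_cancel_right)
qed (simp add: qbinom_def gauss_poly_eq_0)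

lemma generic_base_X: "generic_base (fls_X :: rat fls)"
proof
  show "(fls_X :: rat fls) \<noteq> 0" by simp
  show "(fls_X :: rat fls) ^ n \<noteq> 1" if "0 < n" for n
  proof
    assume "(fls_X :: rat fls) ^ n = 1"
    then have "fls_subdegree ((fls_X :: rat fls) ^ n) = 0" by simp
    then show False using that by (simp add: fls_subdegree_pow)
  qed
qed

lemma positive_base_X: "positive_base fls_X"
proof -
  interpret generic_base "fls_X :: rat fls" by (rule generic_base_X)
  show ?thesis
    by unfold_locales (simp_all add: nonneg_fls_def fls_inverse_X)
qed

lemma nth_gbinom_X:
  "fls_nth (gbinom fls_X m (int n)) k = (if k < 0 then 0 else rat_of_int (coeff (gauss_poly m n) (nat k)))"
proof (induction m n arbitrary: k rule: gauss_poly.induct)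
  case (1 n)
  then show ?case by (auto simp: gbinom_0_left)
next
  case (2 m)
  interpret generic_base "fls_X :: rat fls" by (rule generic_base_X)
  have "gbinom fls_X (Suc m) 0 = (1 :: rat fls)"
    using qfact_rqfact[of "Suc m"] by (simp add: gbinom_def rqfact_def)
  then show ?case by auto
next
  case (3 m n)
  interpret generic_base "fls_X :: rat fls" by (rule generic_base_X)
  have "fls_X powi (1 + int n) * f = fls_shift (- (1 + int n)) f" for f :: "rat fls"
    unfolding fls_X_power_int by (rule fls_X_intpow_times_conv_shift)
  moreover have "nat (k + (- 1 - int n)) = nat k - Suc n" "\<not> k < 1 + int n \<Longrightarrow> \<not> nat k < Suc n"
    "k < 1 + int n \<Longrightarrow> \<not> k < 0 \<Longrightarrow> nat k < Suc n" by auto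
  ultimately show ?case
    using 3 by (auto simp: gbinom_Suc coeff_monom_mult)
qed

section \<open>Coefficients of D as coefficients of a Laurent series\<close>

lemma qcoeff_qbinom:
  "rat_of_int (qcoeff (qbinom (int m) n) (of_int k)) = fls_nth (gbinom fls_X m n) k"
proof (cases "0 \<le> n")
  case True
  then obtain n' where n: "n = int n'" by (metis nonneg_int_cases)
  show ?thesis
    unfolding n qbinom_eq_gauss_poly nth_gbinom_X by (auto simp: qcoeff_def)
next
  case False
  then show ?thesis by (simp add: qbinom_def qcoeff_def gbinom_eq_0)
qed

lemma nth_X_powi_mult: "fls_nth (fls_X powi n * f) k = fls_nth (f :: rat fls) (k - n)"
  unfolding fls_X_power_int fls_X_intpow_times_conv_shift by simp

text \<open>Outside the support of the binomial the added terms are zero, and the support lies in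
  -B..B because |j| \<le> |K j| \<le> |c| + T.\<close>

lemma sum_qcoeff_qbinom:
  fixes K T c B k :: int and E :: "int \<Rightarrow> int"
  assumes "0 < K" "0 \<le> T" "\<bar>c\<bar> + T \<le> B"
  shows "rat_of_int (\<Sum>j\<in>{j. 0 \<le> c - K * j \<and> c - K * j \<le> T}. qcoeff (qbinom T (c - K * j)) (of_int k - of_int (E j))) =
    fls_nth (\<Sum>j=-B..B. fls_X powi E j * gbinom fls_X (nat T) (c - K * j)) k"
proof -
  have "rat_of_int (\<Sum>j\<in>{j. 0 \<le> c - K * j \<and> c - K * j \<le> T}. qcoeff (qbinom T (c - K * j)) (of_int k - of_int (E j))) =
    (\<Sum>j\<in>{j. 0 \<le> c - K * j \<and> c - K * j \<le> T}. fls_nth (gbinom fls_X (nat T) (c - K * j)) (k - E j))"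
    using qcoeff_qbinom[of "nat T"] assms by (simp flip: of_int_diff)
  also have "\<dots> = (\<Sum>j=-B..B. fls_nth (gbinom fls_X (nat T) (c - K * j)) (k - E j))"
  proof (rule sum.mono_neutral_left)
    show "{j. 0 \<le> c - K * j \<and> c - K * j \<le> T} \<subseteq> {-B..B}"
    proof
      fix j assume "j \<in> {j. 0 \<le> c - K * j \<and> c - K * j \<le> T}"
      then have "\<bar>K * j\<bar> \<le> B" using assms by auto
      moreover have "\<bar>j\<bar> \<le> \<bar>K * j\<bar>"
        using mult_right_mono[of 1 K "\<bar>j\<bar>"] assms by (simp add: abs_mult)
      ultimately show "j \<in> {-B..B}" by auto
    qed
    have "gbinom fls_X (nat T) (c - K * j) = (0 :: rat fls)" if "\<not> (0 \<le> c - K * j \<and> c - K * j \<le> T)" for j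
      using that assms(2) by (intro gbinom_eq_0) auto
    then show "\<forall>j\<in>{-B..B} - {j. 0 \<le> c - K * j \<and> c - K * j \<le> T}.
        fls_nth (gbinom fls_X (nat T) (c - K * j) :: rat fls) (k - E j) = 0"
      by auto
  qed simp
  finally show ?thesis unfolding fls_nth_sum nth_X_powi_mult .
qed

text \<open>All exponents of D are integers by the assumptions on E1 and E2, so for non-integral e
  every contribution vanishes.\<close>

lemma D_nonneg_if_nonneg_fls:
  assumes "0 < K" "0 \<le> M + N" "\<bar>M\<bar> + \<bar>i\<bar> + (M + N) \<le> B"
    and E1: "\<And>j. of_int j * ((\<alpha> + \<beta>) * of_int K * of_int j + of_int K * \<beta> - (\<alpha> + \<beta>) * of_int i) = of_int (E1 j)"
    and E2: "\<And>j. ((\<alpha> + \<beta>) * of_int j + \<beta>) * of_int (K * j + i) = of_int (E2 j)"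
    and nn: "nonneg_fls (\<Sum>j=-B..B. fls_X powi E1 j * gbinom fls_X (nat (M + N)) (M - K * j) -
      fls_X powi E2 j * gbinom fls_X (nat (M + N)) (M - K * j - i))"
  shows "D_nonneg K i N M \<alpha> \<beta>"
  unfolding D_nonneg_def
proof
  fix e :: rat
  show "0 \<le> Dcoeff K i N M \<alpha> \<beta> e"
  proof (cases "e \<in> \<int>")
    case True
    then obtain k where k: "e = of_int k" by (metis Ints_cases)
    have c: "M - K * j - i = (M - i) - K * j" for j by simp
    have "rat_of_int (Dcoeff K i N M \<alpha> \<beta> e) = fls_nth (\<Sum>j=-B..B. fls_X powi E1 j * gbinom fls_X (nat (M + N)) (M - K * j) -
      fls_X powi E2 j * gbinom fls_X (nat (M + N)) (M - K * j - i)) k"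
      unfolding Dcoeff_def k E1 E2 c sum_subtractf of_int_diff fls_minus_nth
      by (subst (1 2) sum_qcoeff_qbinom[where B = B]) (use assms(1-3) in auto)
    then have "0 \<le> rat_of_int (Dcoeff K i N M \<alpha> \<beta> e)"
      using nn unfolding nonneg_fls_def by (simp only:)
    then show ?thesis by simp
  next
    case False
    have "e - of_int j \<notin> \<int>" for j
      using False by (metis Ints_add Ints_of_int diff_add_cancel)
    then have "qcoeff f (e - of_int j) = 0" for f j
      by (simp add: qcoeff_def)
    then show ?thesis unfolding Dcoeff_def E1 E2 by simp
  qed
qed

theorem theorem2p6:
  fixes L t n :: nat and p p' r s :: int
  assumes "0 < p" and "p < p'" and "2 \<le> n"
    and "0 < r" and "r < p" and "0 < s" and "s < p'"
  shows "D_nonneg (3^t * 2^n * p') (3^t * 2^n * s)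
     (int L + 3^t * 2^(n-2) + 3^t * 2^(n-1) * (r - s))
     (int L - 3^t * 2^(n-2) - 3^t * 2^(n-1) * (r - s))
     (((4^n - 1) / 3 * (2 * of_int p' - 1) - (2 * 4^n + 1) / 3 * of_int r + of_int p) / 2^n
        - (3^t - 1) * 2^(n-2) + (3^t - 1) * 2^(n-1) * (of_int p' - of_int r))
     (((2 * 4^n + 1) / 3 * of_int r + (4^n - 1) / 3) / 2^n
        + (3^t - 1) * 2^(n-2) + (3^t - 1) * 2^(n-1) * of_int r)"
  (is "D_nonneg ?K ?i ?N ?M ?\<alpha> ?\<beta>")
proof -
  obtain m where n: "n = m + 2" using assms(3) by (metis add.commute le_Suc_ex)
  \<comment> \<open>Large enough both for the supports of the two sums in D and for the condition L
    + s < B of \<open>nonneg_family\<close>.\<close>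
  define B where "B = \<bar>?M\<bar> + \<bar>?i\<bar> + 2 * int L + s + 1"
  interpret hook_data p p' r s B
    by unfold_locales (use assms in \<open>auto simp: B_def\<close>)
  define E where "E = (\<lambda>i. 3 ^ t * (expo i + ((4 ^ (m + 2) - 1) div 3 + 4 ^ (m + 1) * (3 ^ t - 1)) * gain i))"
  have MN: "?M + ?N = 2 * int L" by simp
  define x y :: rat where "x = 3 ^ t" and "y = 2 ^ m"
  have y: "y \<noteq> 0" by (simp add: y_def)
  have pow: "(2 :: rat) ^ n = 4 * y" "(2 :: rat) ^ (n - 1) = 2 * y" "(2 :: rat) ^ (n - 2) = y" "(4 :: rat) ^ n = 16 * y\<^sup>2"
    by (simp_all add: n y_def power2_eq_square flip: power_mult_distrib)
  have K: "of_int ?K = x * (4 * y) * of_int p'" and i: "of_int ?i = x * (4 * y) * of_int s"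
    by (simp_all add: pow x_def)
  \<comment> \<open>The integer division in the coefficient of \<open>gain\<close> is exact, so it
    agrees with the rational (4^n - 1) / 3 of the statement.\<close>
  have "(4 ^ (m + 2) - 1) div 3 * 3 = (4 ^ (m + 2) - 1 :: int)"
  proof -
    have "(4 :: int) ^ (m + 2) mod 3 = 1" by (simp only: power_mod[symmetric, of 4]) simp
    then show ?thesis by presburger
  qed
  then have "of_int ((4 ^ (m + 2) - 1) div 3) * 3 = (of_int (4 ^ (m + 2) - 1) :: rat)"
    by (metis of_int_mult of_int_numeral)
  then have D: "of_int ((4 ^ (m + 2) - 1) div 3 + 4 ^ (m + 1) * (3 ^ t - 1)) = (16 * y\<^sup>2 - 1) / 3 + 4 * y\<^sup>2 * (x - 1)"
    using pow(4) unfolding n by (simp add: x_def field_simps)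
  have rE: "of_int (E i) = x * (of_int (expo i) + ((16 * y\<^sup>2 - 1) / 3 + 4 * y\<^sup>2 * (x - 1)) * of_int (gain i))" for i
    unfolding E_def of_int_mult of_int_add[of "expo i"] D by (simp add: x_def)
  show ?thesis
  proof (rule D_nonneg_if_nonneg_fls)
    show "0 < ?K" using assms by simp
    show "0 \<le> ?M + ?N" "\<bar>?M\<bar> + \<bar>?i\<bar> + (?M + ?N) \<le> B"
      unfolding MN B_def using assms by simp_all
    \<comment> \<open>The factor 2^n in K and i clears the denominators 2^n of the parameters; the
      rest is a polynomial identity in x = 3^t and y = 2^m.\<close>
    show "of_int j * ((?\<alpha> + ?\<beta>) * of_int ?K * of_int j + of_int ?K * ?\<beta> - (?\<alpha> + ?\<beta>) * of_int ?i) = of_int (E (True, j))" for j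
      unfolding K i rE pow using y
      by (simp add: expo_def gain_def x_def[symmetric] field_simps power2_eq_square)
    show "((?\<alpha> + ?\<beta>) * of_int j + ?\<beta>) * of_int (?K * j + ?i) = of_int (E (False, j))" for j
      unfolding of_int_add[of "?K * j"] of_int_mult[of ?K] K i rE pow using y
      by (simp add: expo_def gain_def x_def[symmetric] field_simps power2_eq_square)
    have shift: "?M - ?K * j = int L - 3 ^ t * 2 ^ m * (2 * offset (True, j) + 1)"
      "?M - ?K * j - ?i = int L - 3 ^ t * 2 ^ m * (2 * offset (False, j) + 1)" for j
      by (simp_all add: n offset_def algebra_simps)
    have "nonneg_fls (family_sum fls_X E (\<lambda>i. gbinom fls_X (2 * L) (int L - 3 ^ t * 2 ^ m * (2 * offset i + 1))))"
      unfolding E_def by (rule nonneg_family[OF positive_base_X]) (simp add: B_def)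
    moreover have "nat (?M + ?N) = 2 * L" by simp
    ultimately show "nonneg_fls (\<Sum>j=-B..B. fls_X powi E (True, j) * gbinom fls_X (nat (?M + ?N)) (?M - ?K * j) -
        fls_X powi E (False, j) * gbinom fls_X (nat (?M + ?N)) (?M - ?K * j - ?i))"
      unfolding family_sum_split shift(2) unfolding shift(1) by simp
  qed
qed

end
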